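(* Let $\mathcal{G}$ be a second countable, purely infinite, minimal, étale Cantor groupoid and let $\mu$ be a quasi-invariant, ergodic probability measure on $\mathcal{G}^{(0)}$. Then the Koopman representation of the topological full group $\mathfrak{T}(\mathcal{G})$ on $L^2(\mathcal{G}^{(0)},\mu)$ associated to the natural action of $\mathfrak{T}(\mathcal{G})$ on $\mathcal{G}^{(0)}$ is irreducible.
   Context: A topological groupoid $\mathcal{G}$ has source map $s(g)=g^{-1}g$, range map $r(g)=gg^{-1}$ and unit space $\mathcal{G}^{(0)}$. It is étale if $r$ (equivalently $s$) is a local homeomorphism. It is a Cantor groupoid if $\mathcal{G}^{(0)}$, with the subspace topology, is a Cantor space ($\mathcal{G}$ itself need not be Hausdorff). It is minimal if every orbit $\{r(g): g\in\mathcal{G}, s(g)=u\}$, $u\in\mathcal{G}^{(0)}$, is dense in $\mathcal{G}^{(0)}$. A slice is a subset $B\subseteq\mathcal{G}$ on which $s$ and $r$ are injective. Products of subsets of $\mathcal G$ are formed from products of composable pairs. A clopen set $U\subseteq\mathcal{G}^{(0)}$ is properly infinite if there exist compact open slices $S_1,S_2$ with $s(S_1)=s(S_2)=U$, $r(S_1)\cup r(S_2)\subseteq U$ and $r(S_1)\cap r(S_2)=\emptyset$. $\mathcal{G}$ is purely infinite if every clopen subset of $\mathcal{G}^{(0)}$ is properly infinite. The topological full group $\mathfrak{T}(\mathcal{G})$ is the (countable, discrete) group of compact open slices $B$ with $s(B)=r(B)=\mathcal{G}^{(0)}$, under multiplication and inversion of subsets. Its natural action on $\mathcal{G}^{(0)}$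 is by the homeomorphisms $\alpha_B=r|_B\circ(s|_B)^{-1}$. Measures on $\mathcal{G}^{(0)}$ are Borel. For a probability measure $\mu$ on $\mathcal{G}^{(0)}$ let $\nu_\mu$ be the Borel measure on $\mathcal{G}$ given by $\nu_\mu(E)=\int_{\mathcal{G}^{(0)}}|E\cap s^{-1}(u)|\,d\mu(u)$ (Haar system of counting measures), and let $\nu_\mu^{-1}(E)=\nu_\mu(E^{-1})$. $\mu$ is quasi-invariant if $\nu_\mu$ and $\nu_\mu^{-1}$ are mutually absolutely continuous. A measurable $U\subseteq\mathcal{G}^{(0)}$ is almost invariant if $s(g)\in U\Leftrightarrow r(g)\in U$ for $\nu_\mu$-a.e. $g\in\mathcal{G}$. A quasi-invariant $\mu$ is ergodic if every almost invariant measurable $U$ satisfies $\mu(U)=0$ or $\mu(\mathcal{G}^{(0)}\setminus U)=0$. For a group $G$ acting on $(X,\mu)$ preserving the measure class of $\mu$, the Koopman representation $\kappa$ of $G$ on $L^2(X,\mu)$ is the unitary representation $(\kappa(g)f)(x)=\sqrt{\tfrac{dg_*\mu}{d\mu}(x)}\,f(g^{-1}x)$, where $g_*\mu(A)=\mu(g^{-1}A)$. It is irreducible if it has no proper non-zero closed invariant subspace. (A quasi-invariant measure for $\mathcal{G}$ is quasi-invariant for the action of $\mathfrak{T}(\mathcal{G})$.) *)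

theory Defs
  imports "HOL-Probability.Probability" "HOL-Algebra.Group"
begin

text \<open>The set of arrows is the whole type, whose topology need not be Hausdorff. The value of
  \<open>gmul\<close> is meaningful only on composable pairs.\<close>

record 'g groupoid =
  composable :: "('g \<times> 'g) set"
  gmul :: "'g \<Rightarrow> 'g \<Rightarrow> 'g"
  ginv :: "'g \<Rightarrow> 'g"

definition src :: "'g groupoid \<Rightarrow> 'g \<Rightarrow> 'g" where
  "src G g = gmul G (ginv G g) g"

definition rng :: "'g groupoid \<Rightarrow> 'g \<Rightarrow> 'g" where
  "rng G g = gmul G g (ginv G g)"

definition unit_space :: "'g groupoid \<Rightarrow> 'g set" where
  "unit_space G = range (src G)"

text \<open>The algebraic axioms below are the usual ones for a groupoid given by a partial product and an
  inversion; they imply that \<open>(g, h)\<close> is composable iff \<open>src G g = rng G h\<close>.\<close>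

locale topological_groupoid =
  fixes G :: "'g::topological_space groupoid"
  assumes ginv_ginv: "ginv G (ginv G g) = g"
    and composable_assoc:
      "(g, h) \<in> composable G \<Longrightarrow> (h, k) \<in> composable G \<Longrightarrow>
        (gmul G g h, k) \<in> composable G \<and> (g, gmul G h k) \<in> composable G \<and>
        gmul G (gmul G g h) k = gmul G g (gmul G h k)"
    and composable_ginv: "(ginv G g, g) \<in> composable G"
    and cancel_left: "(g, h) \<in> composable G \<Longrightarrow> gmul G (ginv G g) (gmul G g h) = h"
    and cancel_right: "(g, h) \<in> composable G \<Longrightarrow> gmul G (gmul G g h) (ginv G h) = g"
    and continuous_gmul: "continuous_on (composable G) (\<lambda>(g, h). gmul G g h)"
    and continuous_ginv: "continuous_on UNIV (ginv G)"

definition local_homeomorphism_onto :: "'b::topological_space set \<Rightarrow> ('a::topological_space \<Rightarrow> 'b) \<Rightarrow> bool"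
  where
  "local_homeomorphism_onto Y p \<longleftrightarrow>
    (\<forall>x. \<exists>U q. open U \<and> x \<in> U \<and> openin (top_of_set Y) (p ` U) \<and> homeomorphism U (p ` U) p q)"

locale etale_groupoid = topological_groupoid +
  assumes etale: "local_homeomorphism_onto (unit_space G) (rng G)"

definition cantor_groupoid :: "'g::topological_space groupoid \<Rightarrow> bool" where
  "cantor_groupoid G \<longleftrightarrow>
    top_of_set (unit_space G) homeomorphic_space
      product_topology (\<lambda>_::nat. discrete_topology (UNIV :: bool set)) UNIV"

definition minimal_groupoid :: "'g::topological_space groupoid \<Rightarrow> bool" where
  "minimal_groupoid G \<longleftrightarrow>
    (\<forall>u\<in>unit_space G. unit_space G \<subseteq> closure {rng G g | g. src G g = u})"

definition slice :: "'g groupoid \<Rightarrow> 'g set \<Rightarrow> bool" where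
  "slice G B \<longleftrightarrow> inj_on (src G) B \<and> inj_on (rng G) B"

definition compact_open_slice :: "'g::topological_space groupoid \<Rightarrow> 'g set \<Rightarrow> bool" where
  "compact_open_slice G B \<longleftrightarrow> slice G B \<and> compact B \<and> open B"

definition properly_infinite :: "'g::topological_space groupoid \<Rightarrow> 'g set \<Rightarrow> bool" where
  "properly_infinite G U \<longleftrightarrow>
    (\<exists>S1 S2. compact_open_slice G S1 \<and> compact_open_slice G S2 \<and>
      src G ` S1 = U \<and> src G ` S2 = U \<and>
      rng G ` S1 \<union> rng G ` S2 \<subseteq> U \<and> rng G ` S1 \<inter> rng G ` S2 = {})"

definition purely_infinite :: "'g::topological_space groupoid \<Rightarrow> bool" where
  "purely_infinite G \<longleftrightarrow>
    (\<forall>U. openin (top_of_set (unit_space G)) U \<and> closedin (top_of_set (unit_space G)) U \<longrightarrow>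
      properly_infinite G U)"

definition slice_mult :: "'g groupoid \<Rightarrow> 'g set \<Rightarrow> 'g set \<Rightarrow> 'g set" where
  "slice_mult G A B = {gmul G g h | g h. g \<in> A \<and> h \<in> B \<and> (g, h) \<in> composable G}"

definition topological_full_group :: "'g::topological_space groupoid \<Rightarrow> 'g set monoid" where
  "topological_full_group G =
    \<lparr>carrier = {B. compact_open_slice G B \<and> src G ` B = unit_space G \<and> rng G ` B = unit_space G},
     monoid.mult = slice_mult G,
     one = unit_space G\<rparr>"

definition slice_action :: "'g groupoid \<Rightarrow> 'g set \<Rightarrow> 'g \<Rightarrow> 'g" where
  "slice_action G B u = rng G (the_inv_into B (src G) u)"

text \<open>For a second countable etale groupoid the set function below is a measure, so \<open>measure_of\<close>
  does not fall back to the zero measure.\<close>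

definition groupoid_measure ::
    "'g::topological_space groupoid \<Rightarrow> 'g measure \<Rightarrow> 'g measure" where
  "groupoid_measure G \<mu> = measure_of UNIV (sets borel)
    (\<lambda>E. \<integral>\<^sup>+ u. emeasure (count_space UNIV) (E \<inter> src G -` {u}) \<partial>\<mu>)"

definition groupoid_measure_inv ::
    "'g::topological_space groupoid \<Rightarrow> 'g measure \<Rightarrow> 'g measure" where
  "groupoid_measure_inv G \<mu> = distr (groupoid_measure G \<mu>) borel (ginv G)"

definition quasi_invariant :: "'g::topological_space groupoid \<Rightarrow> 'g measure \<Rightarrow> bool" where
  "quasi_invariant G \<mu> \<longleftrightarrow>
    absolutely_continuous (groupoid_measure G \<mu>) (groupoid_measure_inv G \<mu>) \<and>
    absolutely_continuous (groupoid_measure_inv G \<mu>) (groupoid_measure G \<mu>)"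

definition almost_invariant :: "'g::topological_space groupoid \<Rightarrow> 'g measure \<Rightarrow> 'g set \<Rightarrow> bool" where
  "almost_invariant G \<mu> U \<longleftrightarrow> (AE g in groupoid_measure G \<mu>. src G g \<in> U \<longleftrightarrow> rng G g \<in> U)"

definition ergodic :: "'g::topological_space groupoid \<Rightarrow> 'g measure \<Rightarrow> bool" where
  "ergodic G \<mu> \<longleftrightarrow>
    (\<forall>U\<in>sets \<mu>. almost_invariant G \<mu> U \<longrightarrow> emeasure \<mu> U = 0 \<or> emeasure \<mu> (space \<mu> - U) = 0)"

definition square_integrable :: "'a measure \<Rightarrow> ('a \<Rightarrow> complex) set" where
  "square_integrable M = {f \<in> borel_measurable M. integrable M (\<lambda>x. (cmod (f x))\<^sup>2)}"

definition ae_eq :: "'a measure \<Rightarrow> (('a \<Rightarrow> complex) \<times> ('a \<Rightarrow> complex)) set" where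
  "ae_eq M = {(f, g). f \<in> square_integrable M \<and> g \<in> square_integrable M \<and> (AE x in M. f x = g x)}"

definition L2 :: "'a measure \<Rightarrow> ('a \<Rightarrow> complex) set set" where
  "L2 M = square_integrable M // ae_eq M"

definition L2_class :: "'a measure \<Rightarrow> ('a \<Rightarrow> complex) \<Rightarrow> ('a \<Rightarrow> complex) set" where
  "L2_class M f = ae_eq M `` {f}"

definition L2_dist :: "'a measure \<Rightarrow> ('a \<Rightarrow> complex) \<Rightarrow> ('a \<Rightarrow> complex) \<Rightarrow> real" where
  "L2_dist M f g = sqrt (\<integral>x. (cmod (f x - g x))\<^sup>2 \<partial>M)"

definition closed_subspace_L2 :: "'a measure \<Rightarrow> ('a \<Rightarrow> complex) set set \<Rightarrow> bool" where
  "closed_subspace_L2 M V \<longleftrightarrow>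
    V \<subseteq> L2 M \<and>
    L2_class M (\<lambda>_. 0) \<in> V \<and>
    (\<forall>f\<in>square_integrable M. \<forall>g\<in>square_integrable M.
      L2_class M f \<in> V \<longrightarrow> L2_class M g \<in> V \<longrightarrow> L2_class M (\<lambda>x. f x + g x) \<in> V) \<and>
    (\<forall>c. \<forall>f\<in>square_integrable M. L2_class M f \<in> V \<longrightarrow> L2_class M (\<lambda>x. c * f x) \<in> V) \<and>
    (\<forall>f. \<forall>g\<in>square_integrable M.
      (\<forall>n::nat. f n \<in> square_integrable M \<and> L2_class M (f n) \<in> V) \<longrightarrow>
      (\<lambda>n. L2_dist M (f n) g) \<longlonglongrightarrow> 0 \<longrightarrow> L2_class M g \<in> V)"

definition koopman_fun ::
    "('b, 'c) monoid_scheme \<Rightarrow> ('b \<Rightarrow> 'a \<Rightarrow> 'a) \<Rightarrow> 'a measure \<Rightarrow> 'b \<Rightarrow> ('a \<Rightarrow> complex) \<Rightarrow> 'a \<Rightarrow> complex"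
  where
  "koopman_fun \<Gamma> \<alpha> M \<gamma> f x =
    complex_of_real (sqrt (enn2real (RN_deriv M (distr M M (\<alpha> \<gamma>)) x))) * f (\<alpha> (inv\<^bsub>\<Gamma>\<^esub> \<gamma>) x)"

text \<open>On classes: the saturation of the pointwise images of all representatives, which is a single
  class whenever the action preserves the measure class of \<open>M\<close>.\<close>

definition koopman ::
    "('b, 'c) monoid_scheme \<Rightarrow> ('b \<Rightarrow> 'a \<Rightarrow> 'a) \<Rightarrow> 'a measure \<Rightarrow> 'b
      \<Rightarrow> ('a \<Rightarrow> complex) set \<Rightarrow> ('a \<Rightarrow> complex) set" where
  "koopman \<Gamma> \<alpha> M \<gamma> F = ae_eq M `` (koopman_fun \<Gamma> \<alpha> M \<gamma> ` F)"

definition irreducible_on_L2 ::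
    "('b, 'c) monoid_scheme \<Rightarrow> 'a measure
      \<Rightarrow> ('b \<Rightarrow> ('a \<Rightarrow> complex) set \<Rightarrow> ('a \<Rightarrow> complex) set) \<Rightarrow> bool" where
  "irreducible_on_L2 \<Gamma> M \<pi> \<longleftrightarrow>
    (\<forall>V. closed_subspace_L2 M V \<and> (\<forall>\<gamma>\<in>carrier \<Gamma>. \<forall>F\<in>V. \<pi> \<gamma> F \<in> V) \<longrightarrow>
      V = {L2_class M (\<lambda>_. 0)} \<or> V = L2 M)"

end

theory Submission imports Defs begin

text \<open>
  Let \<open>V\<close> be a closed invariant subspace of \<open>L\<^sup>2(\<mu>)\<close>. The proof shows that \<open>V\<close> is
  invariant under multiplication by indicator functions of measurable sets, hence of the form
  \<open>L\<^sup>2(Y)\<close> for a measurable set \<open>Y\<close>; invariance under the full group makes \<open>Y\<close> almost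
  invariant, and ergodicity makes it null or conull.

  The group elements that do the work are involutions. A compact open slice \<open>T\<close> whose source and
  range are disjoint gives the element \<open>swap_slice T\<close> of the full group which exchanges source and
  range along \<open>T\<close> and fixes all other units.

  The key step is that multiplication by the indicator of a clopen set \<open>W\<close> preserves \<open>V\<close>. Proper
  infiniteness of the unit space gives two slices that compress it onto disjoint pieces \<open>R\<^sub>1\<close> and
  \<open>R\<^sub>2\<close>. If \<open>W\<close> misses \<open>R\<^sub>1\<close>, then \<open>R\<^sub>1\<close> contains infinitely many disjoint copies of \<open>W\<close>, each
  reached from \<open>W\<close> by a compact open slice (\<open>wandering_copies\<close>). The corresponding involutions move the
  part of \<open>f\<close> over \<open>W\<close> to mutually orthogonal places, and move parts of \<open>f\<close> with square-summable
  norms onto \<open>W\<close>. Hence the Cesaro means of the images of \<open>f\<close> converge in norm to \<open>f\<close> with its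
  values on \<open>W\<close> replaced by zero (\<open>restrict_away_from_wandering_set\<close>). Every clopen set is the
  disjoint union of a set that misses \<open>R\<^sub>1\<close> and a set that misses \<open>R\<^sub>2\<close>.

  Indicators preserving \<open>V\<close> form a sigma-algebra, so clopen sets suffice. Approximation
  by simple functions then shows that \<open>V\<close> contains, with \<open>f\<close>, all square integrable functions
  vanishing where \<open>f\<close> does. A set \<open>Y\<close> of largest measure with indicator in \<open>V\<close> therefore determines
  \<open>V\<close>, and its images under the involutions lie in \<open>Y\<close> up to null sets
  (\<open>trivial_if_ergodic\<close>).

  Two facts connect this with the measure on the groupoid. Quasi-invariance implies that almost no
  unit is the source of an arrow ending in a given null set (\<open>AE_arrows_avoid_null_set\<close>), so the
  involutions are nonsingular. Arrows with distinct source and range are covered by countably many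
  slices \<open>T\<close> as above, while the remaining arrows cannot violate invariance, so a set invariant under
  all the involutions is almost invariant for the groupoid (\<open>ergodic_swaps\<close>).
\<close>

section \<open>Square integrable functions\<close>

lemma square_integrableI:
  assumes "f \<in> borel_measurable M" "integrable M (\<lambda>x. (cmod (f x))\<^sup>2)"
  shows "f \<in> square_integrable M"
  using assms by (simp add: square_integrable_def)

lemma square_integrableD:
  assumes "f \<in> square_integrable M"
  shows "f \<in> borel_measurable M" "integrable M (\<lambda>x. (cmod (f x))\<^sup>2)"
  using assms by (simp_all add: square_integrable_def)

lemma square_integrable_dominated:
  assumes g: "g \<in> borel_measurable M" and f: "f \<in> square_integrable M"
    and "AE x in M. cmod (g x) \<le> cmod (f x)"
  shows "g \<in> square_integrable M"
proof (rule square_integrableI[OF g])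
  note [measurable] = g
  have "AE x in M. (cmod (g x))\<^sup>2 \<le> (cmod (f x))\<^sup>2"
    using assms(3) by eventually_elim (auto intro: power_mono)
  then show "integrable M (\<lambda>x. (cmod (g x))\<^sup>2)"
    by (intro Bochner_Integration.integrable_bound[OF square_integrableD(2)[OF f]]) auto
qed

lemma cmod_add_power2_le: "(cmod (a + b))\<^sup>2 \<le> 2 * (cmod a)\<^sup>2 + 2 * (cmod b)\<^sup>2"
proof -
  have "(cmod (a + b))\<^sup>2 \<le> (cmod a + cmod b)\<^sup>2"
    by (intro power_mono norm_triangle_ineq) auto
  also have "\<dots> \<le> 2 * (cmod a)\<^sup>2 + 2 * (cmod b)\<^sup>2"
    using sum_squares_bound[of "cmod a" "cmod b"] by (simp add: power2_sum)
  finally show ?thesis .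
qed

lemma square_integrable_add:
  assumes f: "f \<in> square_integrable M" and g: "g \<in> square_integrable M"
  shows "(\<lambda>x. f x + g x) \<in> square_integrable M"
proof (rule square_integrableI)
  note [measurable] = square_integrableD(1)[OF f] square_integrableD(1)[OF g]
  show "(\<lambda>x. f x + g x) \<in> borel_measurable M" by measurable
  show "integrable M (\<lambda>x. (cmod (f x + g x))\<^sup>2)"
  proof (rule Bochner_Integration.integrable_bound)
    show "integrable M (\<lambda>x. 2 * (cmod (f x))\<^sup>2 + 2 * (cmod (g x))\<^sup>2)"
      using square_integrableD(2)[OF f] square_integrableD(2)[OF g] by simp
    show "AE x in M. norm ((cmod (f x + g x))\<^sup>2) \<le> norm (2 * (cmod (f x))\<^sup>2 + 2 * (cmod (g x))\<^sup>2)"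
      using cmod_add_power2_le by (auto simp: abs_of_nonneg)
  qed measurable
qed

lemma square_integrable_scale:
  assumes f: "f \<in> square_integrable M"
  shows "(\<lambda>x. c * f x) \<in> square_integrable M"
  using square_integrableD[OF f]
  by (intro square_integrableI) (auto simp: norm_mult power_mult_distrib)

lemma square_integrable_indicator:
  assumes f: "f \<in> square_integrable M" and E: "E \<in> sets M"
  shows "(\<lambda>x. indicator E x * f x) \<in> square_integrable M"
proof (rule square_integrable_dominated[OF _ f])
  note [measurable] = square_integrableD(1)[OF f] E
  show "(\<lambda>x. indicator E x * f x) \<in> borel_measurable M" by measurable
qed (auto simp: indicator_def)

section \<open>Nonsingular involutions and their Koopman operators\<close>

text \<open>The condition on null sets is one-sided because an involution is its own inverse: applied twice, it
  gives equality of the measure classes of \<open>M\<close> and of its image.\<close>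

definition nonsingular_involution :: "'a measure \<Rightarrow> ('a \<Rightarrow> 'a) \<Rightarrow> bool" where
  "nonsingular_involution M \<alpha> \<longleftrightarrow> \<alpha> \<in> measurable M M \<and> (\<forall>x\<in>space M. \<alpha> (\<alpha> x) = x) \<and>
    (\<forall>A\<in>null_sets M. \<alpha> -` A \<inter> space M \<in> null_sets M)"

text \<open>For a nonsingular involution of a probability space the derivative is finite almost everywhere, so the
  conversion to a real number loses nothing.\<close>

definition pushforward_density :: "'a measure \<Rightarrow> ('a \<Rightarrow> 'a) \<Rightarrow> 'a \<Rightarrow> real" where
  "pushforward_density M \<alpha> x = enn2real (RN_deriv M (distr M M \<alpha>) x)"

definition weighted_composition :: "'a measure \<Rightarrow> ('a \<Rightarrow> 'a) \<Rightarrow> ('a \<Rightarrow> complex) \<Rightarrow> 'a \<Rightarrow> complex" where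
  "weighted_composition M \<alpha> f x = complex_of_real (sqrt (pushforward_density M \<alpha> x)) * f (\<alpha> x)"

lemma pushforward_density_nonneg: "0 \<le> pushforward_density M \<alpha> x"
  by (simp add: pushforward_density_def)

lemma pushforward_density_measurable [measurable]: "pushforward_density M \<alpha> \<in> borel_measurable M"
  unfolding pushforward_density_def[abs_def] by measurable

lemma nonsingular_involutionD:
  assumes "nonsingular_involution M \<alpha>"
  shows "\<alpha> \<in> measurable M M" "\<And>x. x \<in> space M \<Longrightarrow> \<alpha> (\<alpha> x) = x"
    "\<And>A. A \<in> null_sets M \<Longrightarrow> \<alpha> -` A \<inter> space M \<in> null_sets M"
  using assms by (auto simp: nonsingular_involution_def)

text \<open>Change of variables. The facts about the density below are all instances of it.\<close>

lemma (in prob_space) nn_integral_pushforward_density: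
  assumes \<alpha>: "nonsingular_involution M \<alpha>" and h[measurable]: "h \<in> borel_measurable M"
  shows "(\<integral>\<^sup>+ x. ennreal (pushforward_density M \<alpha> x) * h x \<partial>M) = (\<integral>\<^sup>+ x. h (\<alpha> x) \<partial>M)"
proof -
  note [measurable] = nonsingular_involutionD(1)[OF \<alpha>]
  let ?N = "distr M M \<alpha>"
  have ac: "absolutely_continuous M ?N"
    unfolding absolutely_continuous_def
  proof
    fix A assume A: "A \<in> null_sets M"
    then show "A \<in> null_sets ?N"
      using nonsingular_involutionD(3)[OF \<alpha> A] by (simp add: null_sets_distr_iff null_setsD2)
  qed
  have fin: "AE x in M. RN_deriv M ?N x \<noteq> \<infinity>"
    by (intro RN_deriv_finite ac prob_space_imp_sigma_finite prob_space_distr) auto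
  have "(\<integral>\<^sup>+ x. ennreal (pushforward_density M \<alpha> x) * h x \<partial>M) = (\<integral>\<^sup>+ x. RN_deriv M ?N x * h x \<partial>M)"
    using fin by (intro nn_integral_cong_AE) (auto simp: pushforward_density_def less_top elim!: eventually_mono)
  also have "\<dots> = (\<integral>\<^sup>+ x. h x \<partial>density M (RN_deriv M ?N))"
    by (simp add: nn_integral_density)
  also have "\<dots> = (\<integral>\<^sup>+ x. h x \<partial>?N)"
    using density_RN_deriv[OF ac] by simp
  also have "\<dots> = (\<integral>\<^sup>+ x. h (\<alpha> x) \<partial>M)"
    by (simp add: nn_integral_distr)
  finally show ?thesis .
qed

text \<open>A measurable subset of \<open>F\<close> equals its preimage under \<open>\<alpha>\<close>, so \<open>M\<close> and its image have the same
  restriction to \<open>F\<close>.\<close>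

lemma (in prob_space) pushforward_density_eq_1_on_fixed_points:
  assumes \<alpha>: "nonsingular_involution M \<alpha>" and F[measurable]: "F \<in> sets M"
    and fixed: "\<And>x. x \<in> F \<Longrightarrow> \<alpha> x = x"
  shows "AE x in M. x \<in> F \<longrightarrow> pushforward_density M \<alpha> x = 1"
proof -
  note [measurable] = nonsingular_involutionD(1)[OF \<alpha>]
  let ?f = "\<lambda>x. ennreal (pushforward_density M \<alpha> x) * indicator F x"
  have int: "(\<integral>\<^sup>+ x. ?f x * indicator A x \<partial>M) = emeasure M (F \<inter> A)" if [measurable]: "A \<in> sets M" for A
  proof -
    have eq: "indicator (F \<inter> A) (\<alpha> x) = (indicator (F \<inter> A) x :: ennreal)" if "x \<in> space M" for x
      using fixed[of x] fixed[of "\<alpha> x"] nonsingular_involutionD(2)[OF \<alpha> that]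
      by (auto simp: indicator_def)
    have "(\<integral>\<^sup>+ x. ?f x * indicator A x \<partial>M) = (\<integral>\<^sup>+ x. ennreal (pushforward_density M \<alpha> x) * indicator (F \<inter> A) x \<partial>M)"
      by (intro nn_integral_cong) (auto simp: indicator_def)
    also have "\<dots> = (\<integral>\<^sup>+ x. indicator (F \<inter> A) (\<alpha> x) \<partial>M)"
      by (rule nn_integral_pushforward_density[OF \<alpha>]) measurable
    also have "\<dots> = (\<integral>\<^sup>+ x. indicator (F \<inter> A) x \<partial>M)"
      by (intro nn_integral_cong eq)
    finally show ?thesis by simp
  qed
  have "density M ?f = density M (indicator F)"
  proof (rule measure_eqI)
    fix A assume "A \<in> sets (density M ?f)"
    then have [measurable]: "A \<in> sets M" by simp
    have "(\<integral>\<^sup>+ x. indicator F x * indicator A x \<partial>M) = (\<integral>\<^sup>+ x. indicator (F \<inter> A) x \<partial>M)"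
      by (intro nn_integral_cong) (auto simp: indicator_def)
    then show "emeasure (density M ?f) A = emeasure (density M (indicator F)) A"
      by (simp add: emeasure_density int)
  qed simp
  moreover have "(\<integral>\<^sup>+ x. ?f x \<partial>M) \<noteq> \<infinity>"
    using int[of "space M"] by (simp add: indicator_def if_distrib cong: nn_integral_cong)
  ultimately have "AE x in M. ?f x = indicator F x"
    by (subst finite_density_unique[symmetric]) auto
  then show ?thesis
    by eventually_elim (auto simp: pushforward_density_nonneg ennreal_eq_1)
qed

text \<open>The zero set of the density has measure zero for the image measure, so its preimage is null. Taking
  the preimage once more gives back the zero set, which is then null by nonsingularity.\<close>

lemma (in prob_space) pushforward_density_pos:
  assumes \<alpha>: "nonsingular_involution M \<alpha>"
  shows "AE x in M. 0 < pushforward_density M \<alpha> x"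
proof -
  note [measurable] = nonsingular_involutionD(1)[OF \<alpha>]
  define Z where "Z = {x \<in> space M. pushforward_density M \<alpha> x = 0}"
  have [measurable]: "Z \<in> sets M" unfolding Z_def by measurable
  have "emeasure M (\<alpha> -` Z \<inter> space M) = (\<integral>\<^sup>+ x. indicator Z (\<alpha> x) \<partial>M)"
  proof -
    have "emeasure M (\<alpha> -` Z \<inter> space M) = (\<integral>\<^sup>+ x. indicator (\<alpha> -` Z \<inter> space M) x \<partial>M)"
      by (rule nn_integral_indicator[symmetric]) measurable
    also have "\<dots> = (\<integral>\<^sup>+ x. indicator Z (\<alpha> x) \<partial>M)"
      by (rule nn_integral_cong) (simp add: indicator_def)
    finally show ?thesis .
  qed
  also have "\<dots> = (\<integral>\<^sup>+ x. ennreal (pushforward_density M \<alpha> x) * indicator Z x \<partial>M)"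
    by (rule nn_integral_pushforward_density[OF \<alpha>, symmetric]) measurable
  also have "\<dots> = (\<integral>\<^sup>+ x. 0 \<partial>M)"
    by (intro nn_integral_cong) (auto simp: Z_def indicator_def)
  finally have "\<alpha> -` Z \<inter> space M \<in> null_sets M"
    by (simp add: null_setsI)
  then have "\<alpha> -` (\<alpha> -` Z \<inter> space M) \<inter> space M \<in> null_sets M"
    by (rule nonsingular_involutionD(3)[OF \<alpha>])
  also have "\<alpha> -` (\<alpha> -` Z \<inter> space M) \<inter> space M = Z"
    using nonsingular_involutionD(2)[OF \<alpha>] measurable_space[OF nonsingular_involutionD(1)[OF \<alpha>]]
    by (auto simp: Z_def)
  finally have "AE x in M. x \<notin> Z"
    by (rule AE_not_in)
  then show ?thesis
  proof (rule AE_mp, intro AE_I2 impI)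
    fix x assume "x \<in> space M" "x \<notin> Z"
    then show "0 < pushforward_density M \<alpha> x"
      using pushforward_density_nonneg[of M \<alpha> x] by (auto simp: Z_def)
  qed
qed

text \<open>Change of variables for \<open>|f \<circ> \<alpha>|\<^sup>2\<close> restricted to \<open>E\<close>: since \<open>\<alpha> \<circ> \<alpha>\<close> is the identity, the norm that
  the image has over \<open>E\<close> is the norm that \<open>f\<close> has over the preimage of \<open>E\<close>.\<close>

lemma (in prob_space) weighted_composition_L2:
  assumes \<alpha>: "nonsingular_involution M \<alpha>" and f: "f \<in> square_integrable M"
  shows "weighted_composition M \<alpha> f \<in> square_integrable M" (is ?th1)
    and "E \<in> sets M \<Longrightarrow> (\<integral>x. indicator E x * (cmod (weighted_composition M \<alpha> f x))\<^sup>2 \<partial>M) =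
      (\<integral>x. indicator (\<alpha> -` E) x * (cmod (f x))\<^sup>2 \<partial>M)"
proof -
  note [measurable] = nonsingular_involutionD(1)[OF \<alpha>] square_integrableD(1)[OF f]
  have [measurable]: "weighted_composition M \<alpha> f \<in> borel_measurable M"
    unfolding weighted_composition_def[abs_def] by measurable
  have *: "(\<integral>\<^sup>+x. ennreal (indicator E x * (cmod (weighted_composition M \<alpha> f x))\<^sup>2) \<partial>M) =
      (\<integral>\<^sup>+x. ennreal (indicator (\<alpha> -` E) x * (cmod (f x))\<^sup>2) \<partial>M)" if [measurable]: "E \<in> sets M" for E
  proof -
    have "(\<integral>\<^sup>+x. ennreal (indicator E x * (cmod (weighted_composition M \<alpha> f x))\<^sup>2) \<partial>M) =
      (\<integral>\<^sup>+x. ennreal (pushforward_density M \<alpha> x) * ennreal (indicator E x * (cmod (f (\<alpha> x)))\<^sup>2) \<partial>M)"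
      by (intro nn_integral_cong)
         (simp add: weighted_composition_def norm_mult power_mult_distrib pushforward_density_nonneg
           ennreal_mult[symmetric] mult_ac)
    also have "\<dots> = (\<integral>\<^sup>+x. ennreal (indicator E (\<alpha> x) * (cmod (f (\<alpha> (\<alpha> x))))\<^sup>2) \<partial>M)"
      by (rule nn_integral_pushforward_density[OF \<alpha>]) measurable
    also have "\<dots> = (\<integral>\<^sup>+x. ennreal (indicator (\<alpha> -` E) x * (cmod (f x))\<^sup>2) \<partial>M)"
      by (intro nn_integral_cong) (auto simp: indicator_def nonsingular_involutionD(2)[OF \<alpha>])
    finally show ?thesis .
  qed
  have "(\<integral>\<^sup>+x. ennreal ((cmod (weighted_composition M \<alpha> f x))\<^sup>2) \<partial>M) =
     (\<integral>\<^sup>+x. ennreal (indicator (space M) x * (cmod (weighted_composition M \<alpha> f x))\<^sup>2) \<partial>M)"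
    by (intro nn_integral_cong) auto
  also have "\<dots> \<le> (\<integral>\<^sup>+x. ennreal ((cmod (f x))\<^sup>2) \<partial>M)"
    by (subst *) (auto intro!: nn_integral_mono simp: indicator_def)
  also have "\<dots> < \<infinity>"
    using square_integrableD(2)[OF f] by (subst (asm) integrable_iff_bounded) simp
  finally show ?th1
    by (intro square_integrableI) (simp_all add: integrable_iff_bounded)
  show "(\<integral>x. indicator E x * (cmod (weighted_composition M \<alpha> f x))\<^sup>2 \<partial>M) =
      (\<integral>x. indicator (\<alpha> -` E) x * (cmod (f x))\<^sup>2 \<partial>M)" if E[measurable]: "E \<in> sets M"
  proof -
    have [measurable]: "(\<lambda>x. indicator (\<alpha> -` E) x * (cmod (f x))\<^sup>2) \<in> borel_measurable M"
    proof -
      have "(\<lambda>x. indicator E (\<alpha> x) * (cmod (f x))\<^sup>2) \<in> borel_measurable M" by measurable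
      then show ?thesis by (simp add: indicator_def)
    qed
    show ?thesis
      by (simp add: integral_eq_nn_integral *[OF E])
  qed
qed

section \<open>Closed subspaces of square integrable functions\<close>

text \<open>Subspaces are handled as sets of functions closed under equality almost everywhere; this avoids
  choosing representatives of classes until the end.\<close>

locale closed_L2_subspace = prob_space M for M :: "'a measure" +
  fixes H :: "('a \<Rightarrow> complex) set"
  assumes subset: "H \<subseteq> square_integrable M"
    and zero: "(\<lambda>_. 0) \<in> H"
    and add: "f \<in> H \<Longrightarrow> g \<in> H \<Longrightarrow> (\<lambda>x. f x + g x) \<in> H"
    and scale: "f \<in> H \<Longrightarrow> (\<lambda>x. c * f x) \<in> H"
    and ae_cong: "f \<in> H \<Longrightarrow> g \<in> square_integrable M \<Longrightarrow> AE x in M. f x = g x \<Longrightarrow> g \<in> H"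
    and limit: "(\<And>n::nat. F n \<in> H) \<Longrightarrow> g \<in> square_integrable M \<Longrightarrow>
      (\<lambda>n. \<integral>x. (cmod (F n x - g x))\<^sup>2 \<partial>M) \<longlonglongrightarrow> 0 \<Longrightarrow> g \<in> H"
begin

lemma mem_square_integrable: "f \<in> H \<Longrightarrow> f \<in> square_integrable M"
  using subset by auto

lemma mem_measurable: "f \<in> H \<Longrightarrow> f \<in> borel_measurable M"
  using mem_square_integrable square_integrableD by auto

lemma sum_mem: "finite I \<Longrightarrow> (\<And>i. i \<in> I \<Longrightarrow> f i \<in> H) \<Longrightarrow> (\<lambda>x. \<Sum>i\<in>I. f i x) \<in> H"
  by (induction I rule: finite_induct) (auto intro: zero add)

lemma diff: "f \<in> H \<Longrightarrow> g \<in> H \<Longrightarrow> (\<lambda>x. f x - g x) \<in> H"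
  using add[of f "\<lambda>x. -1 * g x"] scale[of g "-1"] by simp

lemma dominated_limit:
  assumes f: "\<And>n::nat. f n \<in> H" and g: "g \<in> square_integrable M" and w: "w \<in> square_integrable M"
    and bound: "\<And>n x. x \<in> space M \<Longrightarrow> cmod (f n x) \<le> cmod (w x)"
    and conv: "\<And>x. x \<in> space M \<Longrightarrow> (\<lambda>n. f n x) \<longlonglongrightarrow> g x"
  shows "g \<in> H"
proof (rule limit[OF f g])
  note [measurable] = mem_measurable[OF f] square_integrableD(1)[OF g]
  have *: "(\<lambda>n. \<integral>x. (cmod (f n x - g x))\<^sup>2 \<partial>M) \<longlonglongrightarrow> (\<integral>x. 0 \<partial>M)"
  proof (rule integral_dominated_convergence)
    show "integrable M (\<lambda>x. 4 * (cmod (w x))\<^sup>2)"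
      using square_integrableD(2)[OF w] by simp
    show "AE x in M. (\<lambda>n. (cmod (f n x - g x))\<^sup>2) \<longlonglongrightarrow> 0"
    proof (rule AE_I2)
      fix x assume "x \<in> space M"
      then have "(\<lambda>n. (cmod (f n x - g x))\<^sup>2) \<longlonglongrightarrow> (cmod (g x - g x))\<^sup>2"
        by (intro tendsto_intros conv)
      then show "(\<lambda>n. (cmod (f n x - g x))\<^sup>2) \<longlonglongrightarrow> 0" by simp
    qed
    fix n
    show "AE x in M. norm ((cmod (f n x - g x))\<^sup>2) \<le> 4 * (cmod (w x))\<^sup>2"
    proof (rule AE_I2)
      fix x assume x: "x \<in> space M"
      have "cmod (g x) \<le> cmod (w x)"
        using tendsto_norm[OF conv[OF x]] bound[OF x] by (intro LIMSEQ_le_const2) auto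
      then have "(cmod (f n x - g x))\<^sup>2 \<le> (2 * cmod (w x))\<^sup>2"
        using bound[OF x, of n] norm_triangle_ineq4[of "f n x" "g x"] by (intro power_mono) auto
      then show "norm ((cmod (f n x - g x))\<^sup>2) \<le> 4 * (cmod (w x))\<^sup>2"
        by (simp add: power_mult_distrib)
    qed
  qed measurable
  then show "(\<lambda>n. \<integral>x. (cmod (f n x - g x))\<^sup>2 \<partial>M) \<longlonglongrightarrow> 0" by simp
qed

text \<open>The involutions \<open>\<alpha> n\<close> exchange \<open>W\<close> with the disjoint sets \<open>D n\<close>. Let \<open>e n\<close> be the difference
  between the image of \<open>f\<close> under the \<open>n\<close>-th Koopman operator and the restriction of \<open>f\<close> to the
  complement of \<open>W\<close>; it vanishes off \<open>W \<union> D n\<close>. On \<open>W\<close>, its norm is that of \<open>f\<close> on \<open>D n\<close>, and these are square-summable.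
  On the disjoint sets \<open>D n\<close> the differences are orthogonal and bounded. So the square of the norm of the sum of
  the first \<open>N\<close> differences grows at most linearly in \<open>N\<close>, and the averages tend to zero.\<close>

lemma restrict_away_from_wandering_set:
  fixes D :: "nat \<Rightarrow> 'a set"
  assumes f: "f \<in> H" and W[measurable]: "W \<in> sets M" and D[measurable]: "\<And>n. D n \<in> sets M"
    and disj: "disjoint_family D" and WD: "\<And>n. W \<inter> D n = {}"
    and \<alpha>: "\<And>n. nonsingular_involution M (\<alpha> n)"
    and swap: "\<And>n x. x \<in> space M \<Longrightarrow> \<alpha> n x \<in> W \<longleftrightarrow> x \<in> D n"
    and fixed: "\<And>n x. x \<in> space M - (W \<union> D n) \<Longrightarrow> \<alpha> n x = x"
    and stable: "\<And>n. weighted_composition M (\<alpha> n) f \<in> H"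
  shows "(\<lambda>x. indicator (- W) x * f x) \<in> H"
proof -
  note fL2 = mem_square_integrable[OF f]
  define K where "K n = weighted_composition M (\<alpha> n) f" for n
  define S where "S = (\<integral>x. (cmod (f x))\<^sup>2 \<partial>M)"
  have S0: "0 \<le> S" unfolding S_def by simp
  define g where "g = (\<lambda>x. indicator (- W) x * f x)"
  have KL2: "K n \<in> square_integrable M" for n
    unfolding K_def by (rule weighted_composition_L2[OF \<alpha> fL2])
  have KH: "K n \<in> H" for n using stable by (simp add: K_def)
  note [measurable] = square_integrableD(1)[OF fL2] square_integrableD(1)[OF KL2]
  have gL2: "g \<in> square_integrable M"
  proof (rule square_integrable_dominated[OF _ fL2])
    have "(\<lambda>x. f x - indicator W x * f x) \<in> borel_measurable M" by measurable
    then show "g \<in> borel_measurable M"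
      by (rule measurable_cong[THEN iffD1, rotated]) (auto simp: g_def indicator_def)
  qed (auto simp: g_def indicator_def)
  note [measurable] = square_integrableD(1)[OF gL2]
  define e where "e n x = K n x - g x" for n x
  have [measurable]: "e n \<in> borel_measurable M" for n unfolding e_def[abs_def] by measurable
  have iK: "integrable M (\<lambda>x. (cmod (K n x))\<^sup>2)" for n by (rule square_integrableD(2)[OF KL2])
  have if': "integrable M (\<lambda>x. (cmod (f x))\<^sup>2)" by (rule square_integrableD(2)[OF fL2])
  have iiK: "integrable M (\<lambda>x. indicator A x * (cmod (K n x))\<^sup>2)" if "A \<in> sets M" for n A
    using integrable_mult_indicator[OF that iK[of n]] by simp
  have iif: "integrable M (\<lambda>x. indicator A x * (cmod (f x))\<^sup>2)" if "A \<in> sets M" for A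
    using integrable_mult_indicator[OF that if'] by simp
  have "AE x in M. x \<notin> W \<union> D n \<longrightarrow> e n x = 0" for n
  proof -
    have "AE x in M. x \<in> space M - (W \<union> D n) \<longrightarrow> pushforward_density M (\<alpha> n) x = 1"
      by (rule pushforward_density_eq_1_on_fixed_points[OF \<alpha>]) (auto simp: fixed)
    then show ?thesis
      by (rule AE_mp) (auto simp: e_def g_def K_def weighted_composition_def fixed)
  qed
  then have e0: "AE x in M. \<forall>n. x \<notin> W \<union> D n \<longrightarrow> e n x = 0"
    by (rule AE_all_countable[THEN iffD2, OF allI])
  \<comment> \<open>On \<open>W\<close> this is the Cauchy-Schwarz inequality for \<open>N\<close> terms, on \<open>D m\<close> only the \<open>m\<close>-th summand
    is nonzero, and elsewhere all summands vanish.\<close>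
  have pointwise: "AE x in M. (cmod (\<Sum>n<N. e n x))\<^sup>2 \<le>
      (\<Sum>n<N. real N * (indicator W x * (cmod (K n x))\<^sup>2)
         + (2 * (cmod (K n x))\<^sup>2 + 2 * (indicator (D n) x * (cmod (f x))\<^sup>2)))" (is "AE x in M. ?P x") for N
    using e0
  proof eventually_elim
    fix x assume x: "\<forall>n. x \<notin> W \<union> D n \<longrightarrow> e n x = 0"
    consider "x \<in> W" | m where "x \<in> D m" "m < N" "x \<notin> W" | "x \<notin> W" "\<forall>m<N. x \<notin> D m" by blast
    then show "?P x"
    proof cases
      case 1
      have "(cmod (\<Sum>n<N. e n x))\<^sup>2 = (cmod (\<Sum>n<N. K n x))\<^sup>2"
        using 1 by (simp add: e_def g_def)
      also have "\<dots> \<le> (\<Sum>n<N. cmod (K n x))\<^sup>2"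
        by (intro power_mono norm_sum) auto
      also have "\<dots> \<le> (\<Sum>n<N. 1) * (\<Sum>n<N. (cmod (K n x))\<^sup>2)"
        using Cauchy_Schwarz_ineq_sum[of "\<lambda>_. 1" "\<lambda>n. cmod (K n x)" "{..<N}"] by simp
      also have "\<dots> = (\<Sum>n<N. real N * (indicator W x * (cmod (K n x))\<^sup>2))"
        using 1 by (simp add: sum_distrib_left)
      also have "\<dots> \<le> (\<Sum>n<N. real N * (indicator W x * (cmod (K n x))\<^sup>2)
         + (2 * (cmod (K n x))\<^sup>2 + 2 * (indicator (D n) x * (cmod (f x))\<^sup>2)))"
        by (intro sum_mono) simp
      finally show ?thesis .
    next
      case (2 m)
      have "e n x = 0" if "n \<noteq> m" for n
        using x 2 that disj by (auto simp: disjoint_family_on_def)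
      then have "(\<Sum>n<N. e n x) = (\<Sum>n\<in>{m}. e n x)"
        using 2 by (intro sum.mono_neutral_right) auto
      then have "(cmod (\<Sum>n<N. e n x))\<^sup>2 = (cmod (K m x + (- f x)))\<^sup>2"
        using 2 by (simp add: e_def g_def)
      also have "\<dots> \<le> 2 * (cmod (K m x))\<^sup>2 + 2 * (cmod (f x))\<^sup>2"
        using cmod_add_power2_le[of "K m x" "- f x"] by simp
      also have "\<dots> = (\<Sum>n\<in>{m}. real N * (indicator W x * (cmod (K n x))\<^sup>2)
         + (2 * (cmod (K n x))\<^sup>2 + 2 * (indicator (D n) x * (cmod (f x))\<^sup>2)))"
        using 2 by simp
      also have "\<dots> \<le> (\<Sum>n<N. real N * (indicator W x * (cmod (K n x))\<^sup>2)
         + (2 * (cmod (K n x))\<^sup>2 + 2 * (indicator (D n) x * (cmod (f x))\<^sup>2)))"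
        using 2 by (intro sum_mono2) auto
      finally show ?thesis .
    next
      case 3
      then have "(\<Sum>n<N. e n x) = 0" using x by simp
      then show ?thesis by (auto intro!: sum_nonneg)
    qed
  qed
  have K_on_W: "(\<integral>x. indicator W x * (cmod (K n x))\<^sup>2 \<partial>M) = (\<integral>x. indicator (D n) x * (cmod (f x))\<^sup>2 \<partial>M)" for n
    unfolding K_def weighted_composition_L2(2)[OF \<alpha> fL2 W]
    by (intro Bochner_Integration.integral_cong) (auto simp: indicator_def swap)
  have K_total: "(\<integral>x. (cmod (K n x))\<^sup>2 \<partial>M) \<le> S" for n
  proof -
    have "(\<integral>x. (cmod (K n x))\<^sup>2 \<partial>M) = (\<integral>x. indicator (space M) x * (cmod (K n x))\<^sup>2 \<partial>M)"
      by (intro Bochner_Integration.integral_cong) auto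
    also have "\<dots> = (\<integral>x. indicator (\<alpha> n -` space M) x * (cmod (f x))\<^sup>2 \<partial>M)"
      unfolding K_def by (rule weighted_composition_L2(2)[OF \<alpha> fL2]) simp
    also have "\<dots> = S"
      unfolding S_def using measurable_space[OF nonsingular_involutionD(1)[OF \<alpha>]]
      by (intro Bochner_Integration.integral_cong) (auto simp: indicator_def)
    finally show ?thesis by simp
  qed
  have D_total: "(\<Sum>n<N. \<integral>x. indicator (D n) x * (cmod (f x))\<^sup>2 \<partial>M) \<le> S" for N
  proof -
    have "(\<Sum>n<N. \<integral>x. indicator (D n) x * (cmod (f x))\<^sup>2 \<partial>M) = (\<integral>x. (\<Sum>n<N. indicator (D n) x * (cmod (f x))\<^sup>2) \<partial>M)"
      by (rule Bochner_Integration.integral_sum[symmetric]) (simp add: iif)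
    also have "\<dots> = (\<integral>x. indicator (\<Union>n<N. D n) x * (cmod (f x))\<^sup>2 \<partial>M)"
      using disj by (intro Bochner_Integration.integral_cong)
        (auto simp: sum_distrib_right[symmetric] indicator_UN_disjoint disjoint_family_on_def)
    also have "\<dots> \<le> S" unfolding S_def
      by (intro integral_mono iif if') (auto simp: indicator_def)
    finally show ?thesis .
  qed
  \<comment> \<open>Of the constant 5, one unit comes from \<open>W\<close>, two from the images of \<open>f\<close> and two from \<open>f\<close> on the
    sets \<open>D n\<close>.\<close>
  have bound: "(\<integral>x. (cmod (\<Sum>n<N. e n x))\<^sup>2 \<partial>M) \<le> 5 * real N * S" for N
  proof -
    have "(\<integral>x. (cmod (\<Sum>n<N. e n x))\<^sup>2 \<partial>M) \<le> (\<integral>x. (\<Sum>n<N. real N * (indicator W x * (cmod (K n x))\<^sup>2)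
         + (2 * (cmod (K n x))\<^sup>2 + 2 * (indicator (D n) x * (cmod (f x))\<^sup>2))) \<partial>M)"
    proof (rule integral_mono_AE[OF _ _ pointwise])
      show int: "integrable M (\<lambda>x. \<Sum>n<N. real N * (indicator W x * (cmod (K n x))\<^sup>2)
         + (2 * (cmod (K n x))\<^sup>2 + 2 * (indicator (D n) x * (cmod (f x))\<^sup>2)))"
        by (intro Bochner_Integration.integrable_sum Bochner_Integration.integrable_add
            integrable_mult_right iiK iif iK W D)
      show "integrable M (\<lambda>x. (cmod (\<Sum>n<N. e n x))\<^sup>2)"
      proof (rule Bochner_Integration.integrable_bound[OF int])
        show "AE x in M. norm ((cmod (\<Sum>n<N. e n x))\<^sup>2) \<le> norm (\<Sum>n<N. real N * (indicator W x * (cmod (K n x))\<^sup>2)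
         + (2 * (cmod (K n x))\<^sup>2 + 2 * (indicator (D n) x * (cmod (f x))\<^sup>2)))"
          using pointwise[of N] by eventually_elim simp
      qed measurable
    qed
    also have "\<dots> = (\<Sum>n<N. real N * (\<integral>x. indicator W x * (cmod (K n x))\<^sup>2 \<partial>M)
         + (2 * (\<integral>x. (cmod (K n x))\<^sup>2 \<partial>M) + 2 * (\<integral>x. indicator (D n) x * (cmod (f x))\<^sup>2 \<partial>M)))"
      by (simp add: iiK iif iK)
    also have "\<dots> \<le> (\<Sum>n<N. real N * (\<integral>x. indicator (D n) x * (cmod (f x))\<^sup>2 \<partial>M)
         + (2 * S + 2 * (\<integral>x. indicator (D n) x * (cmod (f x))\<^sup>2 \<partial>M)))"
      unfolding K_on_W using K_total by (intro sum_mono) simp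
    also have "\<dots> = real N * (\<Sum>n<N. \<integral>x. indicator (D n) x * (cmod (f x))\<^sup>2 \<partial>M)
        + (2 * real N * S + 2 * (\<Sum>n<N. \<integral>x. indicator (D n) x * (cmod (f x))\<^sup>2 \<partial>M))"
      by (simp add: sum.distrib sum_distrib_left)
    also have "\<dots> \<le> real N * S + (2 * real N * S + 2 * (real N * S))"
    proof (cases N)
      case (Suc k)
      have "(\<Sum>n<N. \<integral>x. indicator (D n) x * (cmod (f x))\<^sup>2 \<partial>M) \<le> real N * S"
        using D_total[of N] S0 Suc by (simp add: algebra_simps add_increasing2 add_increasing)
      with D_total[of N] show ?thesis by (intro add_mono mult_left_mono) auto
    qed simp
    finally show ?thesis by (simp add: mult_ac)
  qed
  show ?thesis
  proof (rule limit)
    show "(\<lambda>x. (1 / of_nat (Suc N)) * (\<Sum>n<Suc N. K n x)) \<in> H" for N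
      by (intro scale sum_mem KH) auto
    show "(\<lambda>x. indicator (- W) x * f x) \<in> square_integrable M" using gL2 by (simp add: g_def)
    show "(\<lambda>N. \<integral>x. (cmod ((1 / of_nat (Suc N)) * (\<Sum>n<Suc N. K n x) - indicator (- W) x * f x))\<^sup>2 \<partial>M) \<longlonglongrightarrow> 0"
    proof (rule tendsto_sandwich[where f = "\<lambda>_. 0"])
      show "\<forall>\<^sub>F N in sequentially.
          (\<integral>x. (cmod ((1 / of_nat (Suc N)) * (\<Sum>n<Suc N. K n x) - indicator (- W) x * f x))\<^sup>2 \<partial>M)
          \<le> 5 * S * inverse (real (Suc N))"
      proof (rule always_eventually, rule allI)
        fix N
        have eq: "(1 / of_nat (Suc N)) * (\<Sum>n<Suc N. K n x) - indicator (- W) x * f x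
           = (1 / of_nat (Suc N)) * (\<Sum>n<Suc N. e n x)" for x
        proof -
          have "(\<Sum>n<Suc N. e n x) = (\<Sum>n<Suc N. K n x) - of_nat (Suc N) * g x"
            unfolding e_def sum_subtractf by simp
          then show ?thesis unfolding g_def
            by (simp only: right_diff_distrib) (simp del: of_nat_Suc)
        qed
        have "(\<integral>x. (cmod ((1 / of_nat (Suc N)) * (\<Sum>n<Suc N. K n x) - indicator (- W) x * f x))\<^sup>2 \<partial>M)
          = (\<integral>x. (1 / real (Suc N))\<^sup>2 * (cmod (\<Sum>n<Suc N. e n x))\<^sup>2 \<partial>M)"
          unfolding eq norm_mult power_mult_distrib norm_divide by (simp del: of_nat_Suc sum.lessThan_Suc)
        also have "\<dots> = (1 / real (Suc N))\<^sup>2 * (\<integral>x. (cmod (\<Sum>n<Suc N. e n x))\<^sup>2 \<partial>M)"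
          by simp
        also have "\<dots> \<le> (1 / real (Suc N))\<^sup>2 * (5 * real (Suc N) * S)"
          by (intro mult_left_mono bound) simp
        also have "\<dots> = 5 * S * inverse (real (Suc N))"
          by (simp add: field_simps power2_eq_square del: of_nat_Suc)
        finally show "
          (\<integral>x. (cmod ((1 / of_nat (Suc N)) * (\<Sum>n<Suc N. K n x) - indicator (- W) x * f x))\<^sup>2 \<partial>M)
          \<le> 5 * S * inverse (real (Suc N))" .
      qed
      show "(\<lambda>N. 5 * S * inverse (real (Suc N))) \<longlonglongrightarrow> 0"
        using tendsto_mult[OF tendsto_const LIMSEQ_inverse_real_of_nat, of "5 * S"] by simp
    qed auto
  qed
qed

text \<open>In terms of Hilbert spaces: the subspace is reduced by the projection given by the indicator of \<open>E\<close>.\<close>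

definition reducing :: "'a set \<Rightarrow> bool" where
  "reducing E \<longleftrightarrow> E \<in> sets M \<and> (\<forall>f\<in>H. (\<lambda>x. indicator E x * f x) \<in> H)"

lemma reducingI: "E \<in> sets M \<Longrightarrow> (\<And>f. f \<in> H \<Longrightarrow> (\<lambda>x. indicator E x * f x) \<in> H) \<Longrightarrow> reducing E"
  by (simp add: reducing_def)

lemma reducing_empty: "reducing {}"
  by (rule reducingI) (auto simp: zero)

lemma reducing_Compl: assumes "reducing E" shows "reducing (space M - E)"
proof (rule reducingI)
  show "space M - E \<in> sets M" using assms by (auto simp: reducing_def)
  fix f assume f: "f \<in> H"
  show "(\<lambda>x. indicator (space M - E) x * f x) \<in> H"
  proof (rule ae_cong)
    show "(\<lambda>x. f x - indicator E x * f x) \<in> H" using assms f by (intro diff) (auto simp: reducing_def)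
    show "(\<lambda>x. indicator (space M - E) x * f x) \<in> square_integrable M"
      using assms mem_square_integrable[OF f] by (intro square_integrable_indicator) (auto simp: reducing_def)
  qed (auto simp: indicator_def)
qed

lemma reducing_Un: assumes "reducing A" "reducing B" shows "reducing (A \<union> B)"
proof (rule reducingI)
  show "A \<union> B \<in> sets M" using assms by (auto simp: reducing_def)
  fix f assume f: "f \<in> H"
  have A: "(\<lambda>x. indicator A x * f x) \<in> H" and B: "(\<lambda>x. indicator B x * f x) \<in> H"
    using assms f by (auto simp: reducing_def)
  have "(\<lambda>x. indicator A x * (indicator B x * f x)) \<in> H" using assms B by (auto simp: reducing_def)
  then have "(\<lambda>x. indicator A x * f x + indicator B x * f x - indicator A x * (indicator B x * f x)) \<in> H"
    by (intro diff add A B)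
  also have "(\<lambda>x. indicator A x * f x + indicator B x * f x - indicator A x * (indicator B x * f x)) =
      (\<lambda>x. indicator (A \<union> B) x * f x)"
    by (auto simp: indicator_def)
  finally show "(\<lambda>x. indicator (A \<union> B) x * f x) \<in> H" .
qed

lemma reducing_UN: assumes "\<And>n::nat. reducing (A n)" shows "reducing (\<Union>n. A n)"
proof (rule reducingI)
  have [measurable]: "A n \<in> sets M" for n using assms by (auto simp: reducing_def)
  show "(\<Union>n. A n) \<in> sets M" by measurable
  fix f assume f: "f \<in> H"
  have fin: "reducing (\<Union>i<n. A i)" for n
    by (induction n) (auto simp: reducing_empty lessThan_Suc intro: reducing_Un assms)
  show "(\<lambda>x. indicator (\<Union>n. A n) x * f x) \<in> H"
  proof (rule dominated_limit)
    show "(\<lambda>x. indicator (\<Union>i<n. A i) x * f x) \<in> H" for n using fin f by (auto simp: reducing_def)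
    show "(\<lambda>x. indicator (\<Union>n. A n) x * f x) \<in> square_integrable M"
      using mem_square_integrable[OF f] by (intro square_integrable_indicator) auto
    show "f \<in> square_integrable M" by (rule mem_square_integrable[OF f])
    show "cmod (indicator (\<Union>i<n. A i) x * f x) \<le> cmod (f x)" for n x by (auto simp: indicator_def)
    show "(\<lambda>n. indicator (\<Union>i<n. A i) x * f x) \<longlonglongrightarrow> indicator (\<Union>n. A n) x * f x" for x
      by (intro tendsto_intros LIMSEQ_indicator_UN)
  qed
qed

text \<open>Reducing sets are closed under complements and countable unions, so it is enough to test generators.\<close>

lemma reducing_all:
  assumes gen: "sets M = sigma_sets (space M) \<C>" and \<C>: "\<And>C. C \<in> \<C> \<Longrightarrow> reducing C" and E: "E \<in> sets M"
  shows "reducing E"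
  using E unfolding gen
proof (induction E rule: sigma_sets.induct)
qed (auto intro: \<C> reducing_empty reducing_Compl reducing_UN)

text \<open>The quotient \<open>g / f\<close> is a pointwise limit of simple functions \<open>s i\<close> of absolute value at most twice that
  of the quotient. Each \<open>s i * f\<close> is a combination of restrictions of \<open>f\<close> to measurable sets, and these products
  converge to \<open>g\<close>, dominated by \<open>2 * g\<close>.\<close>

lemma mem_of_support_subset:
  assumes all: "\<And>E. E \<in> sets M \<Longrightarrow> reducing E" and f: "f \<in> H" and g: "g \<in> square_integrable M"
    and supp: "\<And>x. x \<in> space M \<Longrightarrow> f x = 0 \<Longrightarrow> g x = 0"
  shows "g \<in> H"
proof -
  note [measurable] = mem_measurable[OF f] square_integrableD(1)[OF g]
  define \<phi> where "\<phi> x = g x / f x" for x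
  have \<phi>f: "\<phi> x * f x = g x" if "x \<in> space M" for x
    using supp[OF that] by (auto simp: \<phi>_def)
  have [measurable]: "\<phi> \<in> borel_measurable M" unfolding \<phi>_def[abs_def] by measurable
  from borel_measurable_implies_sequence_metric[of \<phi> M 0] obtain s where
      "(\<forall>i. simple_function M (s i)) \<and> (\<forall>x\<in>space M. (\<lambda>i. s i x) \<longlonglongrightarrow> \<phi> x) \<and>
      (\<forall>i. \<forall>x\<in>space M. dist (s i x) 0 \<le> 2 * dist (\<phi> x) 0)"
    by auto
  then have s: "\<And>i. simple_function M (s i)" "\<And>x. x \<in> space M \<Longrightarrow> (\<lambda>i. s i x) \<longlonglongrightarrow> \<phi> x"
    "\<And>i x. x \<in> space M \<Longrightarrow> cmod (s i x) \<le> 2 * cmod (\<phi> x)"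
    by simp_all
  have eq: "(\<Sum>c\<in>s i ` space M. c * (indicator (s i -` {c} \<inter> space M) x * f x)) = s i x * f x" if x: "x \<in> space M" for x i
  proof -
    have "(\<Sum>c\<in>s i ` space M. c * (indicator (s i -` {c} \<inter> space M) x * f x)) =
      (\<Sum>c\<in>{s i x}. c * (indicator (s i -` {c} \<inter> space M) x * f x))"
      using x s(1)[of i] by (intro sum.mono_neutral_right) (auto simp: simple_function_def indicator_def)
    then show ?thesis using x by simp
  qed
  show ?thesis
  proof (rule dominated_limit[OF _ g square_integrable_scale[OF g, of 2]])
    fix i
    have "(\<lambda>x. \<Sum>c\<in>s i ` space M. c * (indicator (s i -` {c} \<inter> space M) x * f x)) \<in> H"
      using s(1)[of i] all f
      by (intro sum_mem scale) (auto simp: simple_function_def reducing_def)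
    then show "(\<lambda>x. \<Sum>c\<in>s i ` space M. c * (indicator (s i -` {c} \<inter> space M) x * f x)) \<in> H" .
    fix x assume x: "x \<in> space M"
    have "cmod (s i x * f x) \<le> (2 * cmod (\<phi> x)) * cmod (f x)"
      unfolding norm_mult using s(3)[OF x, of i] by (intro mult_right_mono) auto
    also have "\<dots> = cmod (2 * g x)" using \<phi>f[OF x] by (simp add: norm_mult flip: \<phi>f[OF x])
    finally show "cmod (\<Sum>c\<in>s i ` space M. c * (indicator (s i -` {c} \<inter> space M) x * f x)) \<le> cmod (2 * g x)"
      unfolding eq[OF x] .
  next
    fix x assume x: "x \<in> space M"
    show "(\<lambda>i. \<Sum>c\<in>s i ` space M. c * (indicator (s i -` {c} \<inter> space M) x * f x)) \<longlonglongrightarrow> g x"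
      unfolding eq[OF x] \<phi>f[OF x, symmetric] by (intro tendsto_intros s x)
  qed
qed

text \<open>If all measurable sets are reducing, then an indicator of \<open>Y\<close> in \<open>H\<close> forces all square integrable
  functions supported in \<open>Y\<close> into \<open>H\<close>.\<close>

definition spanning :: "'a set \<Rightarrow> bool" where
  "spanning Y \<longleftrightarrow> Y \<in> sets M \<and> (\<lambda>x. indicator Y x) \<in> H"

lemma indicator_square_integrable:
  assumes "Y \<in> sets M" shows "(\<lambda>x. indicator Y x :: complex) \<in> square_integrable M"
proof (rule square_integrableI)
  note [measurable] = assms
  show "(\<lambda>x. indicator Y x :: complex) \<in> borel_measurable M" by measurable
  show "integrable M (\<lambda>x. (cmod (indicator Y x))\<^sup>2)"
    by (rule integrable_const_bound[where B = 1]) (auto simp: indicator_def)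
qed

context
  assumes all: "\<And>E. E \<in> sets M \<Longrightarrow> reducing E"
begin

lemma spanning_support:
  assumes f: "f \<in> H" shows "spanning {x \<in> space M. f x \<noteq> 0}"
proof -
  note [measurable] = mem_measurable[OF f]
  have "{x \<in> space M. f x \<noteq> 0} \<in> sets M" by measurable
  then show ?thesis unfolding spanning_def
    by (auto intro!: mem_of_support_subset[OF all f] indicator_square_integrable)
qed

lemma spanning_Un:
  assumes "spanning A" "spanning B" shows "spanning (A \<union> B)"
proof -
  have "(\<lambda>x. indicator A x + indicator B x) \<in> H"
    using assms by (auto simp: spanning_def intro: add)
  from spanning_support[OF this]
  have "spanning {x \<in> space M. indicator A x + indicator B x \<noteq> (0::complex)}" .
  also have "{x \<in> space M. indicator A x + indicator B x \<noteq> (0::complex)} = A \<union> B"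
  proof -
    have "A \<subseteq> space M" "B \<subseteq> space M"
      using assms by (simp_all add: spanning_def sets.sets_into_space)
    then show ?thesis by (auto simp: indicator_def)
  qed
  finally show ?thesis .
qed

lemma spanning_UN:
  assumes "\<And>n::nat. spanning (A n)" shows "spanning (\<Union>n. A n)"
proof -
  have A: "A n \<in> sets M" for n using assms by (simp add: spanning_def)
  have fin: "spanning (\<Union>i<n. A i)" for n
  proof (induction n)
    case 0
    show ?case by (simp add: spanning_def zero)
  next
    case (Suc n)
    have "(\<Union>i<Suc n. A i) = A n \<union> (\<Union>i<n. A i)" by (simp add: lessThan_Suc)
    then show ?case using spanning_Un[OF assms[of n] Suc] by simp
  qed
  have "(\<lambda>x. indicator (\<Union>n. A n) x) \<in> H"
  proof (rule dominated_limit)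
    show "(\<lambda>x. indicator (\<Union>i<n. A i) x) \<in> H" for n using fin by (auto simp: spanning_def)
    show "(\<lambda>x. indicator (\<Union>n. A n) x :: complex) \<in> square_integrable M"
      using A by (intro indicator_square_integrable) auto
    show "(\<lambda>x. indicator (space M) x :: complex) \<in> square_integrable M"
      by (intro indicator_square_integrable) auto
    show "x \<in> space M \<Longrightarrow> cmod (indicator (\<Union>i<n. A i) x) \<le> cmod (indicator (space M) x)" for n x
      by (auto simp: indicator_def)
    show "(\<lambda>n. indicator (\<Union>i<n. A i) x) \<longlonglongrightarrow> (indicator (\<Union>n. A n) x :: complex)" for x
      by (rule LIMSEQ_indicator_UN)
  qed
  with A show ?thesis by (auto simp: spanning_def)
qed

text \<open>Exhaustion: the measures of spanning sets are bounded, and the union of a sequence of spanning sets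
  whose measures approach the supremum is spanning.\<close>

lemma largest_spanning_set:
  obtains Y where "spanning Y" "\<And>Z. spanning Z \<Longrightarrow> Z - Y \<in> null_sets M"
proof -
  define m where "m = Sup (measure M ` Collect spanning)"
  have bdd: "bdd_above (measure M ` Collect spanning)"
    by (intro bdd_aboveI[of _ 1]) auto
  have "spanning {}" by (simp add: spanning_def zero)
  then have ne: "measure M ` Collect spanning \<noteq> {}" by auto
  have "\<exists>A. spanning A \<and> m - inverse (real (Suc n)) < measure M A" for n
    using less_cSup_iff[OF ne bdd, of "m - inverse (real (Suc n))"] by (auto simp: m_def)
  then obtain A where A: "\<And>n. spanning (A n)" "\<And>n. m - inverse (real (Suc n)) < measure M (A n)"
    by metis
  define Y where "Y = (\<Union>n. A n)"
  have Y: "spanning Y" unfolding Y_def by (rule spanning_UN[OF A(1)])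
  have Ym: "Y \<in> sets M" using Y by (simp add: spanning_def)
  have "m \<le> measure M Y"
  proof (rule LIMSEQ_le_const2)
    show "(\<lambda>n. m - inverse (real (Suc n))) \<longlonglongrightarrow> m"
      using tendsto_diff[OF tendsto_const LIMSEQ_inverse_real_of_nat, of m] by simp
    have "m - inverse (real (Suc n)) \<le> measure M Y" for n
      using A(2)[of n] finite_measure_mono[OF _ Ym, of "A n"] by (force simp: Y_def)
    then show "\<exists>N. \<forall>n\<ge>N. m - inverse (real (Suc n)) \<le> measure M Y" by auto
  qed
  have "Z - Y \<in> null_sets M" if Z: "spanning Z" for Z
  proof -
    have Zm: "Z \<in> sets M" using Z by (simp add: spanning_def)
    have "measure M (Y \<union> Z) \<le> m"
      unfolding m_def using spanning_Un[OF Y Z] by (intro cSup_upper bdd) auto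
    moreover have "measure M (Y \<union> Z) = measure M Y + measure M (Z - Y)"
      using Ym Zm by (rule finite_measure_Union')
    ultimately have "measure M (Z - Y) = 0"
      using \<open>m \<le> measure M Y\<close> measure_nonneg[of M "Z - Y"] by linarith
    then show ?thesis using Ym Zm by (simp add: null_sets_def emeasure_eq_measure)
  qed
  with Y show ?thesis by (rule that)
qed

text \<open>The Koopman image of the indicator of the largest spanning set \<open>Y\<close> is nonzero almost exactly on the
  preimage of \<open>Y\<close>, because the density is positive. So the preimage is spanning, and by maximality it lies in
  \<open>Y\<close> up to a null set. If \<open>Y\<close> is null, so is the support of every member of \<open>H\<close>; if it is conull,
  \<open>H\<close> contains the constants and hence everything.\<close>

lemma trivial_if_ergodic:
  assumes inv: "\<And>\<alpha>. \<alpha> \<in> I \<Longrightarrow> nonsingular_involution M \<alpha>"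
    and stable: "\<And>\<alpha> f. \<alpha> \<in> I \<Longrightarrow> f \<in> H \<Longrightarrow> weighted_composition M \<alpha> f \<in> H"
    and ergodic: "\<And>Y. Y \<in> sets M \<Longrightarrow> (\<And>\<alpha>. \<alpha> \<in> I \<Longrightarrow> \<alpha> -` Y \<inter> space M - Y \<in> null_sets M) \<Longrightarrow>
      Y \<in> null_sets M \<or> space M - Y \<in> null_sets M"
  shows "H = square_integrable M \<or> (\<forall>f\<in>H. AE x in M. f x = 0)"
proof -
  obtain Y where Y: "spanning Y" and max: "\<And>Z. spanning Z \<Longrightarrow> Z - Y \<in> null_sets M"
    using largest_spanning_set by blast
  have [measurable]: "Y \<in> sets M" and YH: "(\<lambda>x. indicator Y x) \<in> H" using Y by (auto simp: spanning_def)
  have "\<alpha> -` Y \<inter> space M - Y \<in> null_sets M" if \<alpha>: "\<alpha> \<in> I" for \<alpha>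
  proof (rule max)
    note [measurable] = nonsingular_involutionD(1)[OF inv[OF \<alpha>]]
    have set: "\<alpha> -` Y \<inter> space M \<in> sets M" by measurable
    let ?f = "weighted_composition M \<alpha> (\<lambda>x. indicator Y x)"
    have "?f \<in> H" by (rule stable[OF \<alpha> YH])
    from spanning_support[OF this]
    have S: "spanning {x \<in> space M. ?f x \<noteq> 0}" .
    have "(\<lambda>x. indicator (\<alpha> -` Y \<inter> space M) x) \<in> H"
    proof (rule ae_cong)
      show "(\<lambda>x. indicator {x \<in> space M. ?f x \<noteq> 0} x) \<in> H" using S by (simp add: spanning_def)
      show "(\<lambda>x. indicator (\<alpha> -` Y \<inter> space M) x :: complex) \<in> square_integrable M"
        by (rule indicator_square_integrable[OF set])
      show "AE x in M. indicator {x \<in> space M. ?f x \<noteq> 0} x = (indicator (\<alpha> -` Y \<inter> space M) x :: complex)"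
        using pushforward_density_pos[OF inv[OF \<alpha>]]
        by eventually_elim (auto simp: weighted_composition_def indicator_def)
    qed
    with set show "spanning (\<alpha> -` Y \<inter> space M)" by (simp add: spanning_def)
  qed
  with ergodic[of Y] consider "Y \<in> null_sets M" | "space M - Y \<in> null_sets M" by auto
  then show ?thesis
  proof cases
    case 1
    have "AE x in M. f x = 0" if f: "f \<in> H" for f
      using AE_not_in[OF 1] AE_not_in[OF max[OF spanning_support[OF f]]] AE_space
      by eventually_elim auto
    then show ?thesis by blast
  next
    case 2
    have "(\<lambda>x. indicator (space M) x) \<in> H"
    proof (rule ae_cong[OF YH])
      show "AE x in M. indicator Y x = (indicator (space M) x :: complex)"
        using AE_not_in[OF 2] AE_space by eventually_elim (auto simp: indicator_def)
    qed (simp add: indicator_square_integrable)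
    from mem_of_support_subset[OF all this] have "g \<in> H" if "g \<in> square_integrable M" for g
      using that by auto
    then show ?thesis using subset by blast
  qed
qed

end

end

section \<open>Passing to classes of functions\<close>

lemma ae_eq_equiv: "equiv (square_integrable M) (ae_eq M)"
proof (rule equivI)
  show "ae_eq M \<subseteq> square_integrable M \<times> square_integrable M" by (auto simp: ae_eq_def)
  show "refl_on (square_integrable M) (ae_eq M)" by (auto simp: refl_on_def ae_eq_def)
  show "sym (ae_eq M)" by (auto simp: sym_def ae_eq_def elim: eventually_mono)
  show "trans (ae_eq M)"
  proof (rule transI)
    fix f g h assume "(f, g) \<in> ae_eq M" "(g, h) \<in> ae_eq M"
    then have *: "f \<in> square_integrable M" "h \<in> square_integrable M"
      "AE x in M. f x = g x" "AE x in M. g x = h x" by (auto simp: ae_eq_def)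
    from *(3,4) have "AE x in M. f x = h x" by eventually_elim simp
    with * show "(f, h) \<in> ae_eq M" by (simp add: ae_eq_def)
  qed
qed

lemma L2_class_eqI:
  assumes "f \<in> square_integrable M" "g \<in> square_integrable M" "AE x in M. f x = g x"
  shows "L2_class M f = L2_class M g"
  unfolding L2_class_def using assms by (intro equiv_class_eq[OF ae_eq_equiv]) (simp add: ae_eq_def)

lemma L2_cases:
  assumes "F \<in> L2 M" obtains f where "f \<in> square_integrable M" "F = L2_class M f"
  using assms unfolding L2_class_def L2_def by (auto elim: quotientE)

lemma (in prob_space) closed_L2_subspace_of_classes:
  assumes V: "closed_subspace_L2 M V"
  shows "closed_L2_subspace M {f \<in> square_integrable M. L2_class M f \<in> V}"
proof unfold_locales
  note V = V[unfolded closed_subspace_L2_def]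
  have zero: "(\<lambda>_. 0) \<in> square_integrable M" by (simp add: square_integrable_def)
  show "(\<lambda>_. 0) \<in> {f \<in> square_integrable M. L2_class M f \<in> V}" using V zero by simp
  show "(\<lambda>x. f x + g x) \<in> {f \<in> square_integrable M. L2_class M f \<in> V}"
    if "f \<in> {f \<in> square_integrable M. L2_class M f \<in> V}" "g \<in> {f \<in> square_integrable M. L2_class M f \<in> V}" for f g
    using V that by (auto intro: square_integrable_add)
  show "(\<lambda>x. c * f x) \<in> {f \<in> square_integrable M. L2_class M f \<in> V}"
    if "f \<in> {f \<in> square_integrable M. L2_class M f \<in> V}" for c f
    using V that by (auto intro: square_integrable_scale)
  show "g \<in> {f \<in> square_integrable M. L2_class M f \<in> V}"
    if "f \<in> {f \<in> square_integrable M. L2_class M f \<in> V}" "g \<in> square_integrable M" "AE x in M. f x = g x" for f g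
    using that L2_class_eqI[of f M g] by auto
  show "g \<in> {f \<in> square_integrable M. L2_class M f \<in> V}"
    if F: "\<And>n::nat. F n \<in> {f \<in> square_integrable M. L2_class M f \<in> V}" and g: "g \<in> square_integrable M"
      and lim: "(\<lambda>n. \<integral>x. (cmod (F n x - g x))\<^sup>2 \<partial>M) \<longlonglongrightarrow> 0" for F g
  proof -
    have "(\<lambda>n. L2_dist M (F n) g) \<longlonglongrightarrow> 0"
      using tendsto_real_sqrt[OF lim] by (simp add: L2_dist_def)
    moreover have "\<forall>n. F n \<in> square_integrable M \<and> L2_class M (F n) \<in> V" using F by auto
    ultimately have "L2_class M g \<in> V" using V g by blast
    then show ?thesis using g by simp
  qed
qed auto

lemma (in prob_space) weighted_composition_cong_AE:
  assumes \<alpha>: "nonsingular_involution M \<alpha>" and fg: "(f, g) \<in> ae_eq M"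
  shows "AE x in M. weighted_composition M \<alpha> f x = weighted_composition M \<alpha> g x"
proof -
  from fg have [measurable]: "f \<in> borel_measurable M" "g \<in> borel_measurable M"
    by (auto simp: ae_eq_def square_integrable_def)
  let ?A = "{x \<in> space M. f x \<noteq> g x}"
  have "?A \<in> sets M" by measurable
  moreover have "AE x in M. x \<notin> ?A" using fg by (auto simp: ae_eq_def)
  ultimately have "?A \<in> null_sets M" by (simp add: AE_iff_null_sets)
  from AE_not_in[OF nonsingular_involutionD(3)[OF \<alpha> this]] AE_space show ?thesis
    by eventually_elim
      (use measurable_space[OF nonsingular_involutionD(1)[OF \<alpha>]] in \<open>auto simp: weighted_composition_def\<close>)
qed

text \<open>The Koopman operator uses the inverse group element, which is the element itself here; that the
  image of a class is a single class is nonsingularity.\<close>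

lemma (in prob_space) koopman_involution:
  assumes \<alpha>: "nonsingular_involution M (\<alpha> \<gamma>)" and inv: "inv\<^bsub>\<Gamma>\<^esub> \<gamma> = \<gamma>" and f: "f \<in> square_integrable M"
  shows "koopman \<Gamma> \<alpha> M \<gamma> (L2_class M f) = L2_class M (weighted_composition M (\<alpha> \<gamma>) f)"
proof -
  have fun_eq: "koopman_fun \<Gamma> \<alpha> M \<gamma> h = weighted_composition M (\<alpha> \<gamma>) h" for h
    by (auto simp: koopman_fun_def weighted_composition_def pushforward_density_def inv)
  have same: "ae_eq M `` {weighted_composition M (\<alpha> \<gamma>) h} = ae_eq M `` {weighted_composition M (\<alpha> \<gamma>) f}"
    if "(f, h) \<in> ae_eq M" for h
  proof (rule equiv_class_eq[OF ae_eq_equiv, symmetric])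
    have h: "h \<in> square_integrable M" using that by (simp add: ae_eq_def)
    show "(weighted_composition M (\<alpha> \<gamma>) f, weighted_composition M (\<alpha> \<gamma>) h) \<in> ae_eq M"
      unfolding ae_eq_def
      using weighted_composition_L2(1)[OF \<alpha> f] weighted_composition_L2(1)[OF \<alpha> h]
        weighted_composition_cong_AE[OF \<alpha> that] by simp
  qed
  have "(f, f) \<in> ae_eq M" using f by (simp add: ae_eq_def)
  then show ?thesis
    unfolding koopman_def L2_class_def fun_eq using same by blast
qed

section \<open>Groupoid algebra and slices\<close>

context topological_groupoid begin

lemma composable_ginv': "(g, ginv G g) \<in> composable G"
  using composable_ginv[of "ginv G g"] by (simp add: ginv_ginv)

text \<open>If \<open>(g, h)\<close> is composable, the axioms make \<open>src G g\<close> a left unit for \<open>h\<close> and \<open>rng G h\<close> a right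
  unit for \<open>g\<close>. These two units are composable, and each equals their product.\<close>

lemma composable_iff: "(g, h) \<in> composable G \<longleftrightarrow> src G g = rng G h"
proof
  assume gh: "(g, h) \<in> composable G"
  have sg_h: "(src G g, h) \<in> composable G" "gmul G (src G g) h = h"
    using composable_assoc[OF composable_ginv gh] cancel_left[OF gh] by (auto simp: src_def)
  have g_rh: "(g, rng G h) \<in> composable G" "gmul G g (rng G h) = g"
    using composable_assoc[OF gh composable_ginv'] cancel_right[OF gh] by (auto simp: rng_def)
  have "gmul G (src G g) (rng G h) = rng G h"
    using composable_assoc[OF sg_h(1) composable_ginv'[of h]] sg_h(2) by (auto simp: rng_def)
  moreover have "gmul G (src G g) (rng G h) = src G g"
    using composable_assoc[OF composable_ginv g_rh(1)] g_rh(2) by (auto simp: src_def)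
  ultimately show "src G g = rng G h" by simp
next
  assume eq: "src G g = rng G h"
  have 1: "(g, src G g) \<in> composable G" "gmul G g (src G g) = g"
    using composable_assoc[OF composable_ginv' composable_ginv] cancel_right[OF composable_ginv', of g]
    by (auto simp: src_def ginv_ginv)
  have 2: "(rng G h, h) \<in> composable G"
    using composable_assoc[OF composable_ginv' composable_ginv] by (auto simp: rng_def)
  show "(g, h) \<in> composable G"
    using composable_assoc[OF 1(1), of h] 1(2) 2 by (simp add: eq)
qed

lemma src_ginv [simp]: "src G (ginv G g) = rng G g"
  and rng_ginv [simp]: "rng G (ginv G g) = src G g"
  by (simp_all add: src_def rng_def ginv_ginv)

lemma src_mult: "src G g = rng G h \<Longrightarrow> src G (gmul G g h) = src G h"
  using composable_assoc[OF _ composable_ginv', of g h] composable_iff by auto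

lemma rng_mult: "src G g = rng G h \<Longrightarrow> rng G (gmul G g h) = rng G g"
  using composable_assoc[OF composable_ginv, of g h] composable_iff by auto

lemma mult_assoc:
  "src G g = rng G h \<Longrightarrow> src G h = rng G k \<Longrightarrow> gmul G (gmul G g h) k = gmul G g (gmul G h k)"
  using composable_assoc[of g h k] composable_iff by auto

lemma src_src [simp]: "src G (src G g) = src G g"
  and rng_src [simp]: "rng G (src G g) = src G g"
  and src_rng [simp]: "src G (rng G g) = rng G g"
  and rng_rng [simp]: "rng G (rng G g) = rng G g"
  using src_mult[of "ginv G g" g, folded src_def] rng_mult[of "ginv G g" g, folded src_def]
    src_mult[of g "ginv G g", folded rng_def] rng_mult[of g "ginv G g", folded rng_def]
  by simp_all

lemma unit_left [simp]: "gmul G (rng G g) g = g"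
  using cancel_right[OF composable_ginv', of g] by (simp add: rng_def ginv_ginv)

lemma unit_right [simp]: "gmul G g (src G g) = g"
proof -
  have "gmul G (gmul G g (ginv G g)) g = gmul G g (gmul G (ginv G g) g)"
    by (rule mult_assoc) simp_all
  with unit_left[of g] show ?thesis by (simp only: src_def rng_def)
qed

lemma src_in_units [simp]: "src G g \<in> unit_space G"
  by (simp add: unit_space_def)

lemma rng_in_units [simp]: "rng G g \<in> unit_space G"
  using src_in_units[of "ginv G g"] by (simp del: src_in_units)

lemma src_unit [simp]: "u \<in> unit_space G \<Longrightarrow> src G u = u"
  and rng_unit [simp]: "u \<in> unit_space G \<Longrightarrow> rng G u = u"
  by (auto simp: unit_space_def)

lemma ginv_unit [simp]: "u \<in> unit_space G \<Longrightarrow> ginv G u = u"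
  using unit_right[of "ginv G u"] by (simp add: src_def[symmetric])

lemma slice_mult_iff:
  "x \<in> slice_mult G A B \<longleftrightarrow> (\<exists>g\<in>A. \<exists>h\<in>B. src G g = rng G h \<and> x = gmul G g h)"
  by (auto simp: slice_mult_def composable_iff)

lemma slice_multI:
  "g \<in> A \<Longrightarrow> h \<in> B \<Longrightarrow> src G g = rng G h \<Longrightarrow> gmul G g h \<in> slice_mult G A B"
  unfolding slice_mult_iff by blast

lemma slice_mult_assoc: "slice_mult G (slice_mult G A B) C = slice_mult G A (slice_mult G B C)"
proof (intro equalityI subsetI)
  fix x assume "x \<in> slice_mult G (slice_mult G A B) C"
  then obtain a b c where *: "a \<in> A" "b \<in> B" "c \<in> C" "src G a = rng G b" "src G (gmul G a b) = rng G c"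
    "x = gmul G (gmul G a b) c"
    by (auto simp: slice_mult_iff)
  have bc: "src G b = rng G c" using *(5) src_mult[OF *(4)] by simp
  have "gmul G b c \<in> slice_mult G B C" using * bc by (intro slice_multI)
  moreover have "src G a = rng G (gmul G b c)" using *(4) rng_mult[OF bc] by simp
  ultimately show "x \<in> slice_mult G A (slice_mult G B C)"
    unfolding *(6) mult_assoc[OF *(4) bc] using *(1) by (simp add: slice_multI)
next
  fix x assume "x \<in> slice_mult G A (slice_mult G B C)"
  then obtain a b c where *: "a \<in> A" "b \<in> B" "c \<in> C" "src G b = rng G c" "src G a = rng G (gmul G b c)"
    "x = gmul G a (gmul G b c)"
    by (auto simp: slice_mult_iff)
  have ab: "src G a = rng G b" using *(5) rng_mult[OF *(4)] by simp
  have "gmul G a b \<in> slice_mult G A B" using * ab by (intro slice_multI)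
  moreover have "src G (gmul G a b) = rng G c" using *(4) src_mult[OF ab] by simp
  ultimately show "x \<in> slice_mult G (slice_mult G A B) C"
    unfolding *(6) mult_assoc[OF ab *(4), symmetric] using *(3) by (simp add: slice_multI)
qed

lemma slice_mult_units_left: "slice_mult G (unit_space G) B = B"
proof (intro equalityI subsetI)
  fix x assume "x \<in> B"
  then show "x \<in> slice_mult G (unit_space G) B"
    unfolding slice_mult_iff by (intro bexI[of _ "rng G x"] bexI[of _ x]) simp_all
qed (auto simp: slice_mult_iff)

lemma slice_mult_units_right: "slice_mult G B (unit_space G) = B"
proof (intro equalityI subsetI)
  fix x assume "x \<in> B"
  then show "x \<in> slice_mult G B (unit_space G)"
    unfolding slice_mult_iff by (intro bexI[of _ "src G x"] bexI[of _ x]) simp_all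
next
  fix x assume "x \<in> slice_mult G B (unit_space G)"
  then obtain g u where "g \<in> B" "u \<in> unit_space G" "src G g = rng G u" "x = gmul G g u"
    unfolding slice_mult_iff by blast
  then show "x \<in> B" using unit_right[of g] by simp
qed

lemma rng_image_slice_mult: "rng G ` slice_mult G A B = rng G ` {a \<in> A. src G a \<in> rng G ` B}"
proof (intro equalityI subsetI)
  fix x assume "x \<in> rng G ` {a \<in> A. src G a \<in> rng G ` B}"
  then obtain a b where ab: "a \<in> A" "b \<in> B" "src G a = rng G b" "x = rng G a" by auto
  then have "gmul G a b \<in> slice_mult G A B" by (auto simp: slice_mult_iff)
  then show "x \<in> rng G ` slice_mult G A B"
    using ab rng_mult[OF ab(3)] by (metis imageI)
qed (auto simp: slice_mult_iff rng_mult)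

lemma src_image_slice_mult: "src G ` slice_mult G A B = src G ` {b \<in> B. rng G b \<in> src G ` A}"
proof (intro equalityI subsetI)
  fix x assume "x \<in> src G ` {b \<in> B. rng G b \<in> src G ` A}"
  then obtain a b where ab: "a \<in> A" "b \<in> B" "src G a = rng G b" "x = src G b" by force
  then have "gmul G a b \<in> slice_mult G A B" by (auto simp: slice_mult_iff)
  then show "x \<in> src G ` slice_mult G A B"
    using ab src_mult[OF ab(3)] by (metis imageI)
next
  fix x assume "x \<in> src G ` slice_mult G A B"
  then obtain a b where ab: "a \<in> A" "b \<in> B" "src G a = rng G b" "x = src G b"
    by (auto simp: slice_mult_iff src_mult)
  then show "x \<in> src G ` {b \<in> B. rng G b \<in> src G ` A}"
    by (metis (mono_tags, lifting) imageI mem_Collect_eq)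
qed

lemma slice_slice_mult:
  assumes "slice G A" "slice G B"
  shows "slice G (slice_mult G A B)"
proof -
  have A: "\<And>x y. x \<in> A \<Longrightarrow> y \<in> A \<Longrightarrow> src G x = src G y \<Longrightarrow> x = y" "\<And>x y. x \<in> A \<Longrightarrow> y \<in> A \<Longrightarrow> rng G x = rng G y \<Longrightarrow> x = y"
    and B: "\<And>x y. x \<in> B \<Longrightarrow> y \<in> B \<Longrightarrow> src G x = src G y \<Longrightarrow> x = y" "\<And>x y. x \<in> B \<Longrightarrow> y \<in> B \<Longrightarrow> rng G x = rng G y \<Longrightarrow> x = y"
    using assms by (auto simp: slice_def inj_on_def)
  show ?thesis
    unfolding slice_def
  proof (intro conjI inj_onI)
    fix x y assume "x \<in> slice_mult G A B" "y \<in> slice_mult G A B"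
    then obtain a b a' b' where *: "a \<in> A" "b \<in> B" "src G a = rng G b" "x = gmul G a b"
      "a' \<in> A" "b' \<in> B" "src G a' = rng G b'" "y = gmul G a' b'"
      by (auto simp: slice_mult_iff)
    show "x = y" if "src G x = src G y"
    proof -
      have "src G b = src G b'" using that * src_mult[OF *(3)] src_mult[OF *(7)] by simp
      then have "b = b'" by (rule B(1)[OF *(2,6)])
      moreover then have "a = a'" using * by (intro A(1)[OF *(1,5)]) simp
      ultimately show ?thesis using * by simp
    qed
    show "x = y" if "rng G x = rng G y"
    proof -
      have "rng G a = rng G a'" using that * rng_mult[OF *(3)] rng_mult[OF *(7)] by simp
      then have "a = a'" by (rule A(2)[OF *(1,5)])
      moreover then have "b = b'" using *(3,7) by (intro B(2)[OF *(2,6)]) simp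
      ultimately show ?thesis using * by simp
    qed
  qed
qed

text \<open>For a slice with disjoint source and range, this is the slice of the involution of the unit space that
  exchanges source and range along \<open>T\<close>.\<close>

definition swap_slice :: "'g set \<Rightarrow> 'g set" where
  "swap_slice T = T \<union> ginv G ` T \<union> (unit_space G - (src G ` T \<union> rng G ` T))"

context
  fixes T
  assumes T: "slice G T" and disj: "src G ` T \<inter> rng G ` T = {}"
begin

lemma ginv_swap: "ginv G ` swap_slice T = swap_slice T"
proof -
  have "ginv G ` (unit_space G - (src G ` T \<union> rng G ` T)) = unit_space G - (src G ` T \<union> rng G ` T)"
    by (auto simp: image_iff intro!: bexI[rotated])
  then show ?thesis
    unfolding swap_slice_def by (simp add: image_Un image_image ginv_ginv Un_commute)
qed

lemma inj_src_swap: "inj_on (src G) (swap_slice T)"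
proof -
  let ?R = "unit_space G - (src G ` T \<union> rng G ` T)"
  have 1: "inj_on (src G) (ginv G ` T)"
    using T by (auto simp: slice_def inj_on_def)
  have 2: "inj_on (src G) ?R" by (auto simp: inj_on_def)
  have 3: "src G ` ?R = ?R" by force
  have 4: "src G ` ginv G ` T = rng G ` T" by (simp add: image_image)
  have disjoint_union: "inj_on (src G) (A \<union> B)"
    if "inj_on (src G) A" "inj_on (src G) B" "src G ` A \<inter> src G ` B = {}" for A B
    using that by (auto simp: inj_on_Un)
  have "inj_on (src G) (T \<union> ginv G ` T)"
    using T disj 1 4 by (intro disjoint_union) (auto simp: slice_def)
  then show ?thesis
    unfolding swap_slice_def
    by (rule disjoint_union[OF _ 2]) (simp only: image_Un 3 4, blast)
qed

lemma slice_swap: "slice G (swap_slice T)"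
  unfolding slice_def
proof
  show "inj_on (src G) (swap_slice T)" by (rule inj_src_swap)
  show "inj_on (rng G) (swap_slice T)"
  proof (rule inj_onI)
    fix x y assume xy: "x \<in> swap_slice T" "y \<in> swap_slice T" "rng G x = rng G y"
    have "ginv G x \<in> swap_slice T" "ginv G y \<in> swap_slice T" using xy ginv_swap by blast+
    then have "ginv G x = ginv G y" using xy(3) inj_onD[OF inj_src_swap, of "ginv G x" "ginv G y"] by simp
    then show "x = y" by (metis ginv_ginv)
  qed
qed

lemma src_swap: "src G ` swap_slice T = unit_space G"
proof -
  have "src G ` ginv G ` T = rng G ` T" by (simp add: image_image)
  moreover have "src G ` (unit_space G - A) = unit_space G - A" for A by force
  moreover have "src G ` T \<subseteq> unit_space G" "rng G ` T \<subseteq> unit_space G" by auto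
  ultimately show ?thesis
    unfolding swap_slice_def image_Un by auto
qed

lemma rng_swap: "rng G ` swap_slice T = unit_space G"
proof -
  have "rng G ` swap_slice T = rng G ` ginv G ` swap_slice T" by (simp add: ginv_swap)
  also have "\<dots> = src G ` swap_slice T" by (simp add: image_image)
  finally show ?thesis by (simp add: src_swap)
qed

text \<open>A slice that is stable under inversion and covers all units contains with \<open>g\<close> no composable partner
  except the inverse of \<open>g\<close>.\<close>

lemma swap_mult_swap: "slice_mult G (swap_slice T) (swap_slice T) = unit_space G"
proof (intro equalityI subsetI)
  fix x assume "x \<in> slice_mult G (swap_slice T) (swap_slice T)"
  then obtain g h where gh: "g \<in> swap_slice T" "h \<in> swap_slice T" "src G g = rng G h" "x = gmul G g h"
    by (auto simp: slice_mult_iff)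
  have "ginv G g \<in> swap_slice T" using gh ginv_swap by blast
  then have "h = ginv G g" using gh slice_swap by (auto simp: slice_def inj_on_def)
  then have "x = rng G g" using gh by (simp add: rng_def)
  then show "x \<in> unit_space G" by simp
next
  fix u assume "u \<in> unit_space G"
  then obtain g where g: "g \<in> swap_slice T" "u = rng G g" using rng_swap by auto
  moreover have "ginv G g \<in> swap_slice T" using g ginv_swap by blast
  ultimately show "u \<in> slice_mult G (swap_slice T) (swap_slice T)"
    unfolding slice_mult_iff by (intro bexI[of _ g] bexI[of _ "ginv G g"]) (simp_all, simp add: rng_def)
qed

lemma slice_action_swap: "g \<in> swap_slice T \<Longrightarrow> slice_action G (swap_slice T) (src G g) = rng G g"
  by (simp add: slice_action_def the_inv_into_f_f inj_src_swap)

lemma slice_action_swap_src: "g \<in> T \<Longrightarrow> slice_action G (swap_slice T) (src G g) = rng G g"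
  by (rule slice_action_swap) (simp add: swap_slice_def)

lemma slice_action_swap_rng: "g \<in> T \<Longrightarrow> slice_action G (swap_slice T) (rng G g) = src G g"
  using slice_action_swap[of "ginv G g"] by (simp add: swap_slice_def)

lemma slice_action_swap_fixed:
  "u \<in> unit_space G \<Longrightarrow> u \<notin> src G ` T \<Longrightarrow> u \<notin> rng G ` T \<Longrightarrow> slice_action G (swap_slice T) u = u"
  using slice_action_swap[of u] by (simp add: swap_slice_def)

lemma slice_action_swap_units: "u \<in> unit_space G \<Longrightarrow> slice_action G (swap_slice T) u \<in> unit_space G"
proof -
  assume "u \<in> unit_space G"
  then obtain g where "g \<in> swap_slice T" "u = src G g" using src_swap by blast
  then show ?thesis using slice_action_swap by simp
qed

lemma slice_action_swap_involution:
  assumes "u \<in> unit_space G"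
  shows "slice_action G (swap_slice T) (slice_action G (swap_slice T) u) = u"
proof -
  obtain g where g: "g \<in> swap_slice T" "u = src G g" using assms src_swap by auto
  have "ginv G g \<in> swap_slice T" using g ginv_swap by blast
  from slice_action_swap[OF this] slice_action_swap[OF g(1)] g(2) show ?thesis by simp
qed

text \<open>Inverses are unique because the product of subsets is associative with the unit space as neutral element.\<close>

lemma inv_swap:
  assumes "swap_slice T \<in> carrier (topological_full_group G)"
  shows "inv\<^bsub>topological_full_group G\<^esub> (swap_slice T) = swap_slice T"
  unfolding m_inv_def
proof (rule the_equality)
  show "swap_slice T \<in> carrier (topological_full_group G) \<and>
    swap_slice T \<otimes>\<^bsub>topological_full_group G\<^esub> swap_slice T = \<one>\<^bsub>topological_full_group G\<^esub> \<and>
    swap_slice T \<otimes>\<^bsub>topological_full_group G\<^esub> swap_slice T = \<one>\<^bsub>topological_full_group G\<^esub>"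
    using assms by (simp add: topological_full_group_def swap_mult_swap)
  fix B assume "B \<in> carrier (topological_full_group G) \<and>
    swap_slice T \<otimes>\<^bsub>topological_full_group G\<^esub> B = \<one>\<^bsub>topological_full_group G\<^esub> \<and>
    B \<otimes>\<^bsub>topological_full_group G\<^esub> swap_slice T = \<one>\<^bsub>topological_full_group G\<^esub>"
  then have "slice_mult G (swap_slice T) B = unit_space G" by (simp add: topological_full_group_def)
  then have "slice_mult G (slice_mult G (swap_slice T) (swap_slice T)) B = swap_slice T"
    by (simp add: slice_mult_assoc slice_mult_units_right)
  then show "B = swap_slice T" by (simp add: swap_mult_swap slice_mult_units_left)
qed

end

end

section \<open>Topology of etale groupoids over a Cantor space\<close>

context topological_groupoid begin

lemma continuous_on_mult:
  assumes "continuous_on A f" "continuous_on A g" "\<And>x. x \<in> A \<Longrightarrow> src G (f x) = rng G (g x)"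
  shows "continuous_on A (\<lambda>x. gmul G (f x) (g x))"
proof -
  have "continuous_on A (\<lambda>x. (f x, g x))" by (intro continuous_intros assms)
  moreover have "(\<lambda>x. (f x, g x)) ` A \<subseteq> composable G"
    using assms(3) by (auto simp: composable_iff)
  ultimately show ?thesis
    using continuous_on_compose2[OF continuous_gmul] by fastforce
qed

lemma continuous_on_ginv: "continuous_on A f \<Longrightarrow> continuous_on A (\<lambda>x. ginv G (f x))"
  by (rule continuous_on_compose2[OF continuous_ginv]) auto

lemma continuous_src: "continuous_on A (src G)"
  unfolding src_def[abs_def] by (intro continuous_on_mult continuous_on_ginv continuous_on_id) simp

lemma continuous_rng: "continuous_on A (rng G)"
  unfolding rng_def[abs_def] by (intro continuous_on_mult continuous_on_ginv continuous_on_id) simp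

lemma open_src_vimage: "open U \<Longrightarrow> open (src G -` U)"
  and open_rng_vimage: "open U \<Longrightarrow> open (rng G -` U)"
  using continuous_src[of UNIV] continuous_rng[of UNIV] by (auto simp: open_vimage)

lemma ginv_image: "ginv G ` A = ginv G -` A"
  by (force simp: ginv_ginv image_iff)

lemma open_ginv_image: "open U \<Longrightarrow> open (ginv G ` U)"
  unfolding ginv_image using continuous_ginv by (auto simp: open_vimage)

lemma compact_ginv_image: "compact U \<Longrightarrow> compact (ginv G ` U)"
  by (intro compact_continuous_image continuous_on_subset[OF continuous_ginv]) auto

end

context etale_groupoid begin

lemma local_inverse_of_rng_in_units:
  obtains U q where "open U" "g \<in> U" "openin (top_of_set (unit_space G)) (rng G ` U)"
    "homeomorphism U (rng G ` U) (rng G) q"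
  using etale unfolding local_homeomorphism_onto_def by blast

text \<open>If the range map is injective on a neighbourhood \<open>U\<close> of a unit, then every \<open>g\<close> near the unit has both
  \<open>g\<close> and \<open>rng G g\<close> in \<open>U\<close>. They have the same range, so \<open>g\<close> equals its range.\<close>

lemma open_units: "open (unit_space G)"
proof (subst open_subopen, intro ballI)
  fix u assume u: "u \<in> unit_space G"
  obtain U q where U: "open U" "u \<in> U" "homeomorphism U (rng G ` U) (rng G) q"
    using local_inverse_of_rng_in_units[of u] by metis
  have inj: "inj_on (rng G) U" using U(3) by (auto simp: homeomorphism_def intro: inj_on_inverseI)
  have "U \<inter> rng G -` U \<subseteq> unit_space G"
  proof
    fix g assume "g \<in> U \<inter> rng G -` U"
    then have "rng G g = g" using inj_onD[OF inj, of "rng G g" g] by simp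
    then show "g \<in> unit_space G" using rng_in_units[of g] by simp
  qed
  then show "\<exists>T. open T \<and> u \<in> T \<and> T \<subseteq> unit_space G"
    using U u by (intro exI[of _ "U \<inter> rng G -` U"]) (auto intro: open_rng_vimage)
qed

lemma local_inverse_of_rng:
  assumes A: "open A" "g \<in> A"
  obtains U q where "open U" "g \<in> U" "U \<subseteq> A" "open (rng G ` U)" "continuous_on (rng G ` U) q"
    "\<And>h. h \<in> U \<Longrightarrow> q (rng G h) = h"
proof -
  obtain U q where U: "open U" "g \<in> U" "openin (top_of_set (unit_space G)) (rng G ` U)"
    "homeomorphism U (rng G ` U) (rng G) q"
    using local_inverse_of_rng_in_units[of g] by metis
  have q: "continuous_on (rng G ` U) q" "\<And>h. h \<in> U \<Longrightarrow> q (rng G h) = h" "q ` rng G ` U = U"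
    using U(4) by (auto simp: homeomorphism_def)
  have oU: "open (rng G ` U)" using U(3) open_units by (simp add: openin_open_eq)
  have "rng G ` (U \<inter> A) = rng G ` U \<inter> q -` A" using q(2) by force
  moreover have "open (rng G ` U \<inter> q -` A)"
    using continuous_open_preimage[OF q(1) oU A(1)] .
  ultimately show ?thesis
    using U A q by (intro that[of "U \<inter> A" q]) (auto intro: continuous_on_subset)
qed

lemma open_rng_image: assumes "open A" shows "open (rng G ` A)"
proof (subst open_subopen, intro ballI)
  fix u assume "u \<in> rng G ` A"
  then obtain g where g: "g \<in> A" "u = rng G g" by auto
  from local_inverse_of_rng[OF assms g(1)] obtain U q where "g \<in> U" "U \<subseteq> A" "open (rng G ` U)" by metis
  then show "\<exists>T. open T \<and> u \<in> T \<and> T \<subseteq> rng G ` A" using g by (intro exI[of _ "rng G ` U"]) auto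
qed

lemma src_image: "src G ` A = rng G ` ginv G ` A"
  by (simp add: image_image)

lemma open_src_image: "open A \<Longrightarrow> open (src G ` A)"
  unfolding src_image by (intro open_rng_image open_ginv_image)

lemma local_inverse_of_src:
  assumes A: "open A" "g \<in> A"
  obtains U q where "open U" "g \<in> U" "U \<subseteq> A" "open (src G ` U)" "continuous_on (src G ` U) q"
    "\<And>h. h \<in> U \<Longrightarrow> q (src G h) = h"
proof -
  obtain U q where U: "open U" "ginv G g \<in> U" "U \<subseteq> ginv G ` A" "open (rng G ` U)" "continuous_on (rng G ` U) q"
    "\<And>h. h \<in> U \<Longrightarrow> q (rng G h) = h"
    using local_inverse_of_rng[OF open_ginv_image[OF A(1)], of "ginv G g"] A(2) by blast
  have eq: "src G ` ginv G ` U = rng G ` U" by (simp add: image_image)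
  show ?thesis
  proof (rule that[of "ginv G ` U" "\<lambda>u. ginv G (q u)"])
    show "open (ginv G ` U)" by (rule open_ginv_image[OF U(1)])
    show "g \<in> ginv G ` U" using U(2) by (simp add: ginv_image)
    show "ginv G ` U \<subseteq> A" using U(3) by (auto simp: ginv_ginv)
    show "open (src G ` ginv G ` U)" unfolding eq by (rule U)
    show "continuous_on (src G ` ginv G ` U) (\<lambda>u. ginv G (q u))"
      unfolding eq by (rule continuous_on_ginv[OF U(5)])
    show "h \<in> ginv G ` U \<Longrightarrow> ginv G (q (src G h)) = h" for h using U(6) by (auto simp: ginv_ginv)
  qed
qed

text \<open>Near a product \<open>x = a b\<close>, a local section \<open>q\<close> of the range map selects a left factor \<open>q (rng G g)\<close> in
  \<open>A\<close> continuously. The remaining right factor \<open>\<phi> g\<close> depends continuously on \<open>g\<close> and equals \<open>b\<close> at \<open>x\<close>,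
  so it stays in \<open>B\<close> nearby.\<close>

lemma open_slice_mult:
  assumes A: "open A" and B: "open B"
  shows "open (slice_mult G A B)"
proof (subst open_subopen, intro ballI)
  fix x assume "x \<in> slice_mult G A B"
  then obtain a b where ab: "a \<in> A" "b \<in> B" "src G a = rng G b" "x = gmul G a b"
    by (auto simp: slice_mult_iff)
  from local_inverse_of_rng[OF A ab(1)] obtain U q where
    U: "open U" "a \<in> U" "U \<subseteq> A" "open (rng G ` U)" "continuous_on (rng G ` U) q"
    "\<And>h. h \<in> U \<Longrightarrow> q (rng G h) = h" by metis
  define O' where "O' = rng G -` rng G ` U"
  define \<phi> where "\<phi> g = gmul G (ginv G (q (rng G g))) g" for g
  have O': "open O'" unfolding O'_def by (rule open_rng_vimage[OF U(4)])
  have q: "q (rng G g) \<in> U" "rng G (q (rng G g)) = rng G g" if "g \<in> O'" for g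
    using that U(6) by (auto simp: O'_def)
  have "continuous_on O' \<phi>" unfolding \<phi>_def[abs_def]
    using q by (intro continuous_on_mult continuous_on_ginv continuous_on_id
        continuous_on_compose2[OF U(5) continuous_rng]) (auto simp: O'_def)
  then have "open (O' \<inter> \<phi> -` B)" using O' B by (rule continuous_open_preimage)
  moreover have "x \<in> O' \<inter> \<phi> -` B"
  proof -
    have "rng G x = rng G a" using ab rng_mult by simp
    moreover have "gmul G (ginv G a) x = b"
      using ab cancel_left[of a b] by (simp add: composable_iff)
    ultimately show ?thesis using ab U by (auto simp: O'_def \<phi>_def)
  qed
  moreover have "O' \<inter> \<phi> -` B \<subseteq> slice_mult G A B"
  proof
    fix g assume g: "g \<in> O' \<inter> \<phi> -` B"
    have "rng G (\<phi> g) = src G (q (rng G g))" unfolding \<phi>_def using q g by (subst rng_mult) auto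
    moreover have "gmul G (q (rng G g)) (\<phi> g) = g"
      using cancel_left[of "ginv G (q (rng G g))" g] q g by (simp add: \<phi>_def composable_iff ginv_ginv)
    ultimately show "g \<in> slice_mult G A B"
      unfolding slice_mult_iff using q g U(3)
      by (intro bexI[of _ "q (rng G g)"] bexI[of _ "\<phi> g"]) auto
  qed
  ultimately show "\<exists>T. open T \<and> x \<in> T \<and> T \<subseteq> slice_mult G A B" by blast
qed

end

lemma open_Diff_of_closedin:
  fixes X :: "'g::topological_space set"
  assumes "open X" "closedin (top_of_set X) W" shows "open (X - W)"
proof -
  have "openin (top_of_set X) (X - W)" using assms(2) by (auto simp: closedin_def)
  then show ?thesis using assms(1) by (simp add: openin_open_eq)
qed

text \<open>The cylinder sets restrict finitely many coordinates; they are products of sets that are open and closed.\<close>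

lemma clopen_basis_Cantor_power:
  assumes "openin (product_topology (\<lambda>_::nat. discrete_topology (UNIV :: bool set)) UNIV) V" "x \<in> V"
  obtains C where "openin (product_topology (\<lambda>_::nat. discrete_topology (UNIV :: bool set)) UNIV) C"
    "closedin (product_topology (\<lambda>_::nat. discrete_topology (UNIV :: bool set)) UNIV) C" "x \<in> C" "C \<subseteq> V"
proof -
  from assms obtain U where U: "finite {i::nat. U i \<noteq> (UNIV::bool set)}" "x \<in> Pi\<^sub>E UNIV U" "Pi\<^sub>E UNIV U \<subseteq> V"
    unfolding openin_product_topology_alt by (auto simp: Ball_def)
  show ?thesis
  proof (rule that[of "Pi\<^sub>E UNIV U"])
    show "openin (product_topology (\<lambda>_::nat. discrete_topology (UNIV :: bool set)) UNIV) (Pi\<^sub>E UNIV U)"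
      using U(1) by (auto simp: openin_PiE_gen)
    show "closedin (product_topology (\<lambda>_::nat. discrete_topology (UNIV :: bool set)) UNIV) (Pi\<^sub>E UNIV U)"
      by (auto simp: closedin_product_topology)
  qed (use U in auto)
qed

locale etale_cantor_groupoid = etale_groupoid G
  for G :: "'g::second_countable_topology groupoid" +
  assumes cantor: "cantor_groupoid G"
begin

definition clopen :: "'g set \<Rightarrow> bool" where
  "clopen W \<longleftrightarrow> W \<subseteq> unit_space G \<and> open W \<and> open (unit_space G - W)"

lemma clopen_alt: "clopen W \<longleftrightarrow> openin (top_of_set (unit_space G)) W \<and> closedin (top_of_set (unit_space G)) W"
  using open_units by (auto simp: clopen_def openin_open_eq closedin_def)

lemma compact_units: "compact (unit_space G)"
proof -
  have "compact_space (product_topology (\<lambda>_::nat. discrete_topology (UNIV :: bool set)) UNIV)"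
    by (auto simp: compact_space_product_topology compact_space_discrete_topology)
  then have "compact_space (top_of_set (unit_space G))"
    using cantor homeomorphic_compact_space unfolding cantor_groupoid_def by blast
  then show ?thesis by (simp add: compact_space_def compactin_subtopology)
qed

lemma Hausdorff_units: "Hausdorff_space (top_of_set (unit_space G))"
proof -
  have "Hausdorff_space (product_topology (\<lambda>_::nat. discrete_topology (UNIV :: bool set)) UNIV)"
    by (auto simp: Hausdorff_space_product_topology)
  then show ?thesis
    using cantor homeomorphic_Hausdorff_space unfolding cantor_groupoid_def by blast
qed

lemma clopen_basis:
  assumes U: "open U" and u: "u \<in> U" "u \<in> unit_space G"
  obtains W where "clopen W" "u \<in> W" "W \<subseteq> U"
proof -
  let ?P = "product_topology (\<lambda>_::nat. discrete_topology (UNIV :: bool set)) UNIV"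
  obtain f g where fg: "homeomorphic_maps (top_of_set (unit_space G)) ?P f g"
    using cantor unfolding cantor_groupoid_def homeomorphic_space_def by blast
  then have f: "homeomorphic_map (top_of_set (unit_space G)) ?P f" by (rule homeomorphic_maps_imp_map)
  have "openin (top_of_set (unit_space G)) (U \<inter> unit_space G)"
    by (metis Int_commute U openin_open_Int)
  then have "openin ?P (f ` (U \<inter> unit_space G))"
    using homeomorphic_map_openness_eq[OF f] by blast
  then obtain C where C: "openin ?P C" "closedin ?P C" "f u \<in> C" "C \<subseteq> f ` (U \<inter> unit_space G)"
    using clopen_basis_Cantor_power[of "f ` (U \<inter> unit_space G)" "f u"] u by blast
  have cont: "continuous_map (top_of_set (unit_space G)) ?P f" using f homeomorphic_imp_continuous_map by blast
  have inj: "inj_on f (unit_space G)" using homeomorphic_imp_injective_map[OF f] by simp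
  show ?thesis
  proof (rule that[of "{x \<in> unit_space G. f x \<in> C}"])
    show "clopen {x \<in> unit_space G. f x \<in> C}"
      unfolding clopen_alt
      using openin_continuous_map_preimage[OF cont C(1)] closedin_continuous_map_preimage[OF cont C(2)] by simp
    show "{x \<in> unit_space G. f x \<in> C} \<subseteq> U" using C(4) inj by (auto simp: inj_on_def)
  qed (use u C in auto)
qed

text \<open>The space of arrows need not be Hausdorff. This separation property of units replaces the Hausdorff property
  in the arguments below.\<close>

lemma clopen_separation:
  assumes "u \<in> unit_space G" "v \<in> unit_space G" "u \<noteq> v"
  obtains W where "clopen W" "u \<in> W" "v \<notin> W"
proof -
  obtain U V where UV: "openin (top_of_set (unit_space G)) U"
    "openin (top_of_set (unit_space G)) V" "u \<in> U" "v \<in> V" "disjnt U V"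
    using Hausdorff_units assms unfolding Hausdorff_space_def by (metis topspace_euclidean_subtopology)
  have "open U" using UV open_units by (simp add: openin_open_eq)
  from clopen_basis[OF this UV(3) assms(1)] obtain W where "clopen W" "u \<in> W" "W \<subseteq> U" by metis
  with UV that show ?thesis by (auto simp: disjnt_def)
qed

lemma clopen_compact: "clopen W \<Longrightarrow> compact W"
proof -
  assume W: "clopen W"
  have "compact (unit_space G \<inter> - (unit_space G - W))"
    using W by (intro compact_Int_closed compact_units) (simp only: clopen_def closed_def double_complement)
  also have "unit_space G \<inter> - (unit_space G - W) = W" using W by (auto simp: clopen_def)
  finally show ?thesis .
qed

lemma compact_open_imp_clopen:
  assumes "W \<subseteq> unit_space G" "open W" "compact W" shows "clopen W"
proof -
  have "closedin (top_of_set (unit_space G)) W"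
    using assms by (intro compactin_imp_closedin[OF Hausdorff_units]) (auto simp: compactin_subtopology)
  then show ?thesis using assms open_units by (auto simp: clopen_def open_Diff_of_closedin)
qed

lemma clopen_units: "clopen (unit_space G)"
  and clopen_Int: "clopen V \<Longrightarrow> clopen W \<Longrightarrow> clopen (V \<inter> W)"
  and clopen_Un: "clopen V \<Longrightarrow> clopen W \<Longrightarrow> clopen (V \<union> W)"
  and clopen_Diff: "clopen V \<Longrightarrow> clopen W \<Longrightarrow> clopen (V - W)"
proof -
  show "clopen (unit_space G)" using open_units by (simp add: clopen_def)
  assume V: "clopen V" and W: "clopen W"
  have "unit_space G - V \<inter> W = (unit_space G - V) \<union> (unit_space G - W)"
    "unit_space G - (V \<union> W) = (unit_space G - V) \<inter> (unit_space G - W)"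
    "V - W = V \<inter> (unit_space G - W)" "unit_space G - (V - W) = (unit_space G - V) \<union> W"
    using V W by (auto simp: clopen_def)
  with V W show "clopen (V \<inter> W)" "clopen (V \<union> W)" "clopen (V - W)"
    by (auto simp: clopen_def intro: open_Int open_Un)
qed

lemma clopen_src_image: "compact_open_slice G B \<Longrightarrow> clopen (src G ` B)"
  and clopen_rng_image: "compact_open_slice G B \<Longrightarrow> clopen (rng G ` B)"
  by (auto intro!: compact_open_imp_clopen compact_continuous_image continuous_src continuous_rng
      open_src_image open_rng_image simp: compact_open_slice_def)

lemma compact_open_slice_clopen: "clopen W \<Longrightarrow> compact_open_slice G W"
  using clopen_compact[of W] by (auto simp: compact_open_slice_def slice_def inj_on_def clopen_def subset_iff)

text \<open>Sources and ranges are units, and distinct units are separated by a clopen set.\<close>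

lemma closed_composable: "closed {(g, h). src G g = rng G h}"
proof -
  have "- {(g, h). src G g = rng G h} =
    (\<Union>W\<in>Collect clopen. (src G -` W) \<times> (rng G -` (unit_space G - W)))"
    (is "?L = ?R")
  proof (intro equalityI subsetI)
    fix p assume "p \<in> ?L"
    then have "src G (fst p) \<noteq> rng G (snd p)" by (auto simp: case_prod_beta)
    from clopen_separation[OF src_in_units rng_in_units this] show "p \<in> ?R"
      by (auto simp: mem_Times_iff)
  qed auto
  moreover have "open ?R"
    by (intro open_UN ballI open_Times open_src_vimage open_rng_vimage) (auto simp: clopen_def)
  ultimately show ?thesis by (simp add: closed_def)
qed

text \<open>The composable pairs form a closed subset of the compact product of \<open>A\<close> and \<open>B\<close>.\<close>

lemma compact_slice_mult:
  assumes "compact A" "compact B"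
  shows "compact (slice_mult G A B)"
proof -
  let ?C = "(A \<times> B) \<inter> {(g, h). src G g = rng G h}"
  have "compact ?C" by (intro compact_Int_closed compact_Times assms closed_composable)
  moreover have "continuous_on ?C (\<lambda>(g, h). gmul G g h)"
    by (rule continuous_on_subset[OF continuous_gmul]) (auto simp: composable_iff)
  ultimately have "compact ((\<lambda>(g, h). gmul G g h) ` ?C)" by (rule compact_continuous_image[rotated])
  also have "(\<lambda>(g, h). gmul G g h) ` ?C = slice_mult G A B"
  proof (intro equalityI subsetI)
    fix x assume "x \<in> slice_mult G A B"
    then obtain g h where "g \<in> A" "h \<in> B" "src G g = rng G h" "x = gmul G g h"
      by (auto simp: slice_mult_iff)
    then show "x \<in> (\<lambda>(g, h). gmul G g h) ` ?C" by (intro image_eqI[of _ _ "(g, h)"]) auto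
  qed (auto intro: slice_multI)
  finally show ?thesis .
qed

lemma compact_open_slice_mult:
  "compact_open_slice G A \<Longrightarrow> compact_open_slice G B \<Longrightarrow> compact_open_slice G (slice_mult G A B)"
  by (simp add: compact_open_slice_def slice_slice_mult compact_slice_mult open_slice_mult)

lemma swap_in_full_group:
  assumes T: "compact_open_slice G T" and disj: "src G ` T \<inter> rng G ` T = {}"
  shows "swap_slice T \<in> carrier (topological_full_group G)"
proof -
  have sT: "slice G T" using T by (simp add: compact_open_slice_def)
  have rest: "clopen (unit_space G - (src G ` T \<union> rng G ` T))"
    using T by (intro clopen_Diff clopen_Un clopen_units clopen_src_image clopen_rng_image)
  have "compact (swap_slice T)" "open (swap_slice T)"
    unfolding swap_slice_def using T rest clopen_compact[OF rest]
    by (auto intro!: compact_Un open_Un compact_ginv_image open_ginv_image simp: compact_open_slice_def clopen_def)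
  then show ?thesis
    using slice_swap[OF sT disj] src_swap[OF sT disj] rng_swap[OF sT disj]
    by (simp add: topological_full_group_def compact_open_slice_def)
qed

text \<open>Source and range have disjoint clopen neighbourhoods, and near \<open>g\<close> both maps are injective. The image
  of a local section of the source map over a small clopen set is compact, and it is open because it is the part
  of an open set of arrows that lies over the clopen set.\<close>

lemma compact_open_slice_basis:
  assumes g: "src G g \<noteq> rng G g"
  obtains T where "compact_open_slice G T" "src G ` T \<inter> rng G ` T = {}" "g \<in> T"
proof -
  obtain W where W: "clopen W" "src G g \<in> W" "rng G g \<notin> W"
    using clopen_separation[OF src_in_units rng_in_units g] by metis
  define A where "A = src G -` W \<inter> rng G -` (unit_space G - W)"
  have A: "open A" "g \<in> A" using W
    by (auto simp: A_def clopen_def intro!: open_Int open_src_vimage open_rng_vimage)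
  obtain U q where U: "open U" "g \<in> U" "U \<subseteq> A" "\<And>h. h \<in> U \<Longrightarrow> q (rng G h) = h"
    using local_inverse_of_rng[OF A] by metis
  obtain N p where N: "open N" "g \<in> N" "N \<subseteq> U" "open (src G ` N)" "continuous_on (src G ` N) p"
    "\<And>h. h \<in> N \<Longrightarrow> p (src G h) = h"
    using local_inverse_of_src[OF U(1,2)] by metis
  obtain V where V: "clopen V" "src G g \<in> V" "V \<subseteq> src G ` N"
    using clopen_basis[OF N(4), of "src G g"] N(2) by auto
  define T where "T = N \<inter> src G -` V"
  have "T = p ` V"
  proof (intro equalityI subsetI)
    fix x assume "x \<in> T"
    then show "x \<in> p ` V" using N(6)[of x] by (intro image_eqI[of _ _ "src G x"]) (auto simp: T_def)
  next
    fix x assume "x \<in> p ` V"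
    then obtain h where "h \<in> N" "src G h \<in> V" "x = p (src G h)" using V(3) by blast
    then show "x \<in> T" using N(6) by (simp add: T_def)
  qed
  then have "compact T"
    using clopen_compact[OF V(1)] continuous_on_subset[OF N(5) V(3)] by (simp add: compact_continuous_image)
  moreover have "open T" unfolding T_def using V(1) by (intro open_Int N(1) open_src_vimage) (simp add: clopen_def)
  moreover have "slice G T"
    unfolding slice_def
  proof
    show "inj_on (src G) T" using N(6) by (intro inj_on_inverseI[of _ p]) (auto simp: T_def)
    show "inj_on (rng G) T" using N(3) U(4) by (intro inj_on_inverseI[of _ q]) (auto simp: T_def)
  qed
  moreover have "src G ` T \<inter> rng G ` T = {}" using N(3) U(3) by (force simp: T_def A_def)
  moreover have "g \<in> T" using N V by (simp add: T_def)
  ultimately show ?thesis using that by (simp add: compact_open_slice_def)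
qed

end

context etale_cantor_groupoid begin

lemma rng_image_slice_mult_disjoint:
  assumes "slice G S" "rng G ` A \<inter> rng G ` B = {}"
  shows "rng G ` slice_mult G S A \<inter> rng G ` slice_mult G S B = {}"
proof -
  have inj: "inj_on (rng G) S" using assms(1) by (simp add: slice_def)
  have False if "x \<in> S" "y \<in> S" "src G x \<in> rng G ` A" "src G y \<in> rng G ` B" "rng G x = rng G y" for x y
  proof -
    have "x = y" using inj that by (auto dest: inj_onD)
    then show False using that assms(2) by blast
  qed
  then show ?thesis unfolding rng_image_slice_mult by blast
qed

lemma rng_image_slice_mult_subset: "rng G ` slice_mult G A B \<subseteq> rng G ` A"
  unfolding rng_image_slice_mult by auto

lemma src_image_slice_mult_full:
  "src G ` A = unit_space G \<Longrightarrow> src G ` slice_mult G A B = src G ` B"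
  unfolding src_image_slice_mult by auto

text \<open>The slices are \<open>S1 S2\<^sup>n S1\<close> restricted to \<open>W\<close>. The ranges of \<open>S2\<^sup>n S1\<close> are disjoint: removing common
  factors \<open>S2\<close> reduces this to the disjointness of the ranges of \<open>S1\<close> and \<open>S2\<close>. The extra factor \<open>S1\<close> on the
  left keeps them disjoint and puts them into the range of \<open>S1\<close>, away from \<open>W\<close>.\<close>

lemma wandering_copies:
  assumes S1: "compact_open_slice G S1" "src G ` S1 = unit_space G"
    and S2: "compact_open_slice G S2" "src G ` S2 = unit_space G"
    and disj: "rng G ` S1 \<inter> rng G ` S2 = {}"
    and W: "clopen W" "W \<inter> rng G ` S1 = {}"
  obtains T :: "nat \<Rightarrow> 'g set" where "\<And>n. compact_open_slice G (T n)" "\<And>n. src G ` T n = W"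
    "\<And>n. W \<inter> rng G ` T n = {}" "disjoint_family (\<lambda>n. rng G ` T n)"
proof -
  define P where "P n = (slice_mult G S2 ^^ n) S1" for n
  have P_Suc: "P (Suc n) = slice_mult G S2 (P n)" for n by (simp add: P_def)
  have P: "compact_open_slice G (P n) \<and> src G ` P n = unit_space G" for n
  proof (induction n)
    case 0
    show ?case using S1 by (simp add: P_def)
  next
    case (Suc n)
    then show ?case using S2 by (simp add: P_Suc compact_open_slice_mult src_image_slice_mult_full)
  qed
  have P_disj: "rng G ` P n \<inter> rng G ` P (n + Suc k) = {}" for n k
  proof (induction n)
    case 0
    have P0: "P 0 = S1" by (simp add: P_def)
    have "rng G ` P (Suc k) \<subseteq> rng G ` S2" unfolding P_Suc by (rule rng_image_slice_mult_subset)
    then show ?case unfolding add_0 P0 using disj by (meson disjoint_iff subset_iff)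
  next
    case (Suc n)
    then show ?case
      using rng_image_slice_mult_disjoint[of S2 "P n" "P (n + Suc k)"] S2 by (simp add: P_Suc compact_open_slice_def)
  qed
  have P_disj': "rng G ` P m \<inter> rng G ` P n = {}" if "m \<noteq> n" for m n
    using that
  proof (induction m n rule: linorder_wlog)
    case (le m n)
    then have "n = m + Suc (n - m - 1)" by simp
    then show ?case using P_disj by metis
  next
    case (sym m n)
    then show ?case by (simp add: Int_commute)
  qed
  define T where "T n = slice_mult G (slice_mult G S1 (P n)) W" for n
  have W_slice: "compact_open_slice G W" by (rule compact_open_slice_clopen[OF W(1)])
  have W_sub: "W \<subseteq> unit_space G" using W(1) by (simp add: clopen_def)
  have src_W: "src G ` W = W" using W_sub by (force simp: image_iff)
  have T_sub: "rng G ` T n \<subseteq> rng G ` slice_mult G S1 (P n)" for n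
    unfolding T_def by (rule rng_image_slice_mult_subset)
  show ?thesis
  proof (rule that[of T])
    show "compact_open_slice G (T n)" for n
      unfolding T_def using P S1 W_slice by (intro compact_open_slice_mult) auto
    show "src G ` T n = W" for n
      unfolding T_def using P S1 src_W by (simp add: src_image_slice_mult_full)
    show "W \<inter> rng G ` T n = {}" for n
      using T_sub[of n] rng_image_slice_mult_subset[of S1 "P n"] W(2) by blast
    show "disjoint_family (\<lambda>n. rng G ` T n)"
      unfolding disjoint_family_on_def
    proof (intro ballI impI)
      fix m n :: nat assume "m \<noteq> n"
      from rng_image_slice_mult_disjoint[OF _ P_disj'[OF this], of S1] S1
      have "rng G ` slice_mult G S1 (P m) \<inter> rng G ` slice_mult G S1 (P n) = {}"
        by (simp add: compact_open_slice_def)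
      then show "rng G ` T m \<inter> rng G ` T n = {}" using T_sub[of m] T_sub[of n] by blast
    qed
  qed
qed

end

section \<open>The measure on the groupoid\<close>

locale measured_etale_cantor_groupoid = etale_cantor_groupoid G + prob_space \<mu>
  for G :: "'g::second_countable_topology groupoid" and \<mu> :: "'g measure" +
  assumes sets_\<mu>: "sets \<mu> = sets (restrict_space borel (unit_space G))"
begin

lemma space_\<mu>: "space \<mu> = unit_space G"
  using sets_eq_imp_space_eq[OF sets_\<mu>] by (simp add: space_restrict_space)

lemma sets_\<mu>_iff: "A \<in> sets \<mu> \<longleftrightarrow> A \<subseteq> unit_space G \<and> A \<in> sets borel"
  unfolding sets_\<mu> using open_units by (subst sets_restrict_space_iff) auto

lemma clopen_sets: "clopen W \<Longrightarrow> W \<in> sets \<mu>"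
  by (auto simp: sets_\<mu>_iff clopen_def)

text \<open>By the Lindelof property an open set of units is a countable union of clopen sets.\<close>

lemma sets_\<mu>_generated_by_clopen: "sets \<mu> = sigma_sets (space \<mu>) (Collect clopen)"
proof (intro equalityI)
  have "sets (borel :: 'g measure) = sigma_sets UNIV {S. open S}"
    by (simp add: borel_def)
  then have "sets \<mu> = (\<inter>) (unit_space G) ` sigma_sets UNIV {S. open S}"
    unfolding sets_\<mu> sets_restrict_space by simp
  also have "\<dots> = sigma_sets (unit_space G) ((\<inter>) (unit_space G) ` {S. open S})"
    by (rule sigma_sets_Int) (auto intro: open_units)
  also have "\<dots> \<subseteq> sigma_sets (unit_space G) (Collect clopen)"
  proof (rule sigma_sets_mono, rule subsetI)
    fix U assume "U \<in> (\<inter>) (unit_space G) ` {S. open S}"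
    then have U: "open U" "U \<subseteq> unit_space G" using open_units by auto
    define \<F> where "\<F> = {W. clopen W \<and> W \<subseteq> U}"
    have "\<And>W. W \<in> \<F> \<Longrightarrow> open W" by (auto simp: \<F>_def clopen_def)
    then obtain \<F>' where F: "\<F>' \<subseteq> \<F>" "countable \<F>'" "\<Union>\<F>' = \<Union>\<F>"
      by (rule Lindelof)
    have "\<Union>\<F> = U"
    proof (intro equalityI subsetI)
      fix u assume "u \<in> U"
      with clopen_basis[OF U(1)] U(2) obtain W where "clopen W" "u \<in> W" "W \<subseteq> U" by blast
      then show "u \<in> \<Union>\<F>" by (auto simp: \<F>_def)
    qed (auto simp: \<F>_def)
    moreover have "\<Union>\<F>' \<in> sigma_sets (unit_space G) (Collect clopen)"
      using F by (intro sigma_sets_UNION sigma_sets.Basic) (auto simp: \<F>_def)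
    ultimately show "U \<in> sigma_sets (unit_space G) (Collect clopen)" using F(3) by simp
  qed
  finally show "sets \<mu> \<subseteq> sigma_sets (space \<mu>) (Collect clopen)" by (simp add: space_\<mu>)
  show "sigma_sets (space \<mu>) (Collect clopen) \<subseteq> sets \<mu>"
    by (rule sets.sigma_sets_subset) (auto intro: clopen_sets)
qed

text \<open>On a set where the source map has a continuous inverse \<open>q\<close> with open domain, the source image of a Borel
  set \<open>E\<close> is the preimage of \<open>E\<close> under \<open>q\<close>, hence Borel. Countably many such sets suffice.\<close>

lemma countable_cover_by_sections:
  obtains U :: "nat \<Rightarrow> 'g set" where "(\<Union>n. U n) = UNIV" "\<And>n. open (U n)" "\<And>n. inj_on (src G) (U n)"
    "\<And>n E. E \<in> sets borel \<Longrightarrow> src G ` (E \<inter> U n) \<in> sets \<mu>"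
proof -
  define \<F> where "\<F> = {U. open U \<and> inj_on (src G) U \<and> (\<forall>E\<in>sets borel. src G ` (E \<inter> U) \<in> sets \<mu>)}"
  have cover: "\<Union>\<F> = UNIV"
  proof -
    have "\<exists>U\<in>\<F>. g \<in> U" for g
    proof -
      obtain U q where U: "open U" "g \<in> U" "open (src G ` U)" "continuous_on (src G ` U) q"
        "\<And>h. h \<in> U \<Longrightarrow> q (src G h) = h"
        using local_inverse_of_src[of UNIV g] by auto
      have "src G ` (E \<inter> U) \<in> sets \<mu>" if E: "E \<in> sets borel" for E
      proof -
        have "q \<in> borel_measurable (restrict_space borel (src G ` U))"
          by (rule borel_measurable_continuous_on_restrict[OF U(4)])
        from measurable_sets[OF this E]
        have "q -` E \<inter> src G ` U \<in> sets (restrict_space borel (src G ` U))"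
          by (simp add: space_restrict_space)
        then have "q -` E \<inter> src G ` U \<in> sets borel"
          using U(3) by (subst (asm) sets_restrict_space_iff) auto
        moreover have "q -` E \<inter> src G ` U = src G ` (E \<inter> U)" using U(5) by force
        ultimately show ?thesis by (auto simp: sets_\<mu>_iff)
      qed
      moreover have "inj_on (src G) U" using U(5) by (rule inj_on_inverseI)
      ultimately show ?thesis using U unfolding \<F>_def by blast
    qed
    then show ?thesis by blast
  qed
  have "\<And>U. U \<in> \<F> \<Longrightarrow> open U" by (simp add: \<F>_def)
  then obtain \<F>' where F: "\<F>' \<subseteq> \<F>" "countable \<F>'" "\<Union>\<F>' = \<Union>\<F>"
    by (rule Lindelof)
  have "\<F>' \<noteq> {}" using F(3) cover by auto
  then have r: "range (from_nat_into \<F>') = \<F>'" using F(2) by (rule range_from_nat_into)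
  then have "from_nat_into \<F>' n \<in> \<F>" for n using F(1) by (metis rangeI subsetD)
  then show ?thesis
    using r F(3) cover by (intro that[of "from_nat_into \<F>'"]) (auto simp: \<F>_def)
qed

lemma src_image_measurable:
  assumes "E \<in> sets borel" shows "src G ` E \<in> sets \<mu>"
proof -
  obtain U :: "nat \<Rightarrow> 'g set" where U: "(\<Union>n. U n) = UNIV" "\<And>n. src G ` (E \<inter> U n) \<in> sets \<mu>"
    using countable_cover_by_sections assms by metis
  have "src G ` E = (\<Union>n. src G ` (E \<inter> U n))" using U(1) by (auto simp: set_eq_iff image_iff) blast
  then show ?thesis using U(2) by auto
qed

text \<open>Cut \<open>E\<close> into countably many disjoint pieces on which the source map is injective. The number of points
  over \<open>u\<close> is then the number of pieces whose source image contains \<open>u\<close>.\<close>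

lemma fibre_count_measurable:
  assumes "E \<in> sets borel"
  shows "(\<lambda>u. emeasure (count_space UNIV) (E \<inter> src G -` {u})) \<in> borel_measurable \<mu>"
proof -
  obtain U :: "nat \<Rightarrow> 'g set" where U: "(\<Union>n. U n) = UNIV" "\<And>n. open (U n)" "\<And>n. inj_on (src G) (U n)"
    using countable_cover_by_sections by metis
  define E' where "E' n = E \<inter> disjointed U n" for n
  have E': "E' n \<in> sets borel" for n
  proof -
    have "range U \<subseteq> sets borel" using U(2) by auto
    from sets.range_disjointed_sets[OF this] assms show ?thesis
      unfolding E'_def by (intro sets.Int) auto
  qed
  have "emeasure (count_space UNIV) (E \<inter> src G -` {u}) = (\<Sum>n. indicator (src G ` E' n) u)" for u
  proof -
    have "E \<inter> src G -` {u} = (\<Union>n. E' n \<inter> src G -` {u})"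
      using U(1) UN_disjointed_eq[of U] by (auto simp: E'_def)
    also have "emeasure (count_space UNIV) \<dots> = (\<Sum>n. emeasure (count_space UNIV) (E' n \<inter> src G -` {u}))"
      using disjoint_family_disjointed[of U]
      by (intro suminf_emeasure[symmetric]) (auto simp: E'_def disjoint_family_on_def)
    also have "(\<lambda>n. emeasure (count_space UNIV) (E' n \<inter> src G -` {u})) = (\<lambda>n. indicator (src G ` E' n) u)"
    proof
      fix n
      show "emeasure (count_space UNIV) (E' n \<inter> src G -` {u}) = indicator (src G ` E' n) u"
      proof (cases "u \<in> src G ` E' n")
        case True
        then obtain g where g: "g \<in> E' n" "u = src G g" by auto
        have "E' n \<subseteq> U n" using disjointed_subset[of U n] by (auto simp: E'_def)
        then have "E' n \<inter> src G -` {u} = {g}" using g U(3)[of n] by (auto simp: inj_on_def)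
        then show ?thesis using True by simp
      next
        case False
        then have "E' n \<inter> src G -` {u} = {}" by auto
        then show ?thesis using False by simp
      qed
    qed
    finally show ?thesis .
  qed
  moreover have "(\<lambda>u. \<Sum>n. indicator (src G ` E' n) u :: ennreal) \<in> borel_measurable \<mu>"
  proof -
    note [measurable] = src_image_measurable[OF E']
    show ?thesis by measurable
  qed
  ultimately show ?thesis by simp
qed

lemma sets_groupoid_measure [simp]: "sets (groupoid_measure G \<mu>) = sets borel"
  and space_groupoid_measure [simp]: "space (groupoid_measure G \<mu>) = UNIV"
  using sets.sigma_sets_eq[of "borel :: 'g measure"] by (simp_all add: groupoid_measure_def)

text \<open>Measurability of the fibre counts gives countable additivity, by which the measure takes the
  values given in its definition.\<close>

lemma emeasure_groupoid_measure:
  assumes E: "E \<in> sets borel"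
  shows "emeasure (groupoid_measure G \<mu>) E = (\<integral>\<^sup>+ u. emeasure (count_space UNIV) (E \<inter> src G -` {u}) \<partial>\<mu>)"
proof (rule emeasure_measure_of[OF groupoid_measure_def])
  show "positive (sets (groupoid_measure G \<mu>)) (\<lambda>E. \<integral>\<^sup>+ u. emeasure (count_space UNIV) (E \<inter> src G -` {u}) \<partial>\<mu>)"
    by (simp add: positive_def)
  show "countably_additive (sets (groupoid_measure G \<mu>)) (\<lambda>E. \<integral>\<^sup>+ u. emeasure (count_space UNIV) (E \<inter> src G -` {u}) \<partial>\<mu>)"
  proof (rule countably_additiveI)
    fix A :: "nat \<Rightarrow> 'g set" assume A: "range A \<subseteq> sets (groupoid_measure G \<mu>)" "disjoint_family A"
    have "(\<Sum>i. \<integral>\<^sup>+ u. emeasure (count_space UNIV) (A i \<inter> src G -` {u}) \<partial>\<mu>) =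
      (\<integral>\<^sup>+ u. (\<Sum>i. emeasure (count_space UNIV) (A i \<inter> src G -` {u})) \<partial>\<mu>)"
      using A(1) by (intro nn_integral_suminf[symmetric] fibre_count_measurable) auto
    also have "\<dots> = (\<integral>\<^sup>+ u. emeasure (count_space UNIV) (\<Union> (range A) \<inter> src G -` {u}) \<partial>\<mu>)"
    proof (rule nn_integral_cong)
      fix u
      have "(\<Sum>i. emeasure (count_space UNIV) (A i \<inter> src G -` {u})) =
        emeasure (count_space UNIV) (\<Union>i. A i \<inter> src G -` {u})"
        using A(2) by (intro suminf_emeasure) (auto simp: disjoint_family_on_def)
      then show "(\<Sum>i. emeasure (count_space UNIV) (A i \<inter> src G -` {u})) =
        emeasure (count_space UNIV) (\<Union> (range A) \<inter> src G -` {u})" by simp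
    qed
    finally show "(\<Sum>i. \<integral>\<^sup>+ u. emeasure (count_space UNIV) (A i \<inter> src G -` {u}) \<partial>\<mu>) =
      (\<integral>\<^sup>+ u. emeasure (count_space UNIV) (\<Union> (range A) \<inter> src G -` {u}) \<partial>\<mu>)" .
  qed
qed (use E in auto)

lemma null_sets_groupoid_measure_iff:
  assumes E: "E \<in> sets borel"
  shows "E \<in> null_sets (groupoid_measure G \<mu>) \<longleftrightarrow> (AE u in \<mu>. E \<inter> src G -` {u} = {})"
proof -
  have "E \<in> null_sets (groupoid_measure G \<mu>) \<longleftrightarrow> (\<integral>\<^sup>+ u. emeasure (count_space UNIV) (E \<inter> src G -` {u}) \<partial>\<mu>) = 0"
    using E by (simp add: null_sets_def emeasure_groupoid_measure)
  also have "\<dots> \<longleftrightarrow> (AE u in \<mu>. emeasure (count_space UNIV) (E \<inter> src G -` {u}) = 0)"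
    by (rule nn_integral_0_iff_AE[OF fibre_count_measurable[OF E]])
  also have "\<dots> \<longleftrightarrow> (AE u in \<mu>. E \<inter> src G -` {u} = {})"
    by (simp add: emeasure_count_space_eq_0)
  finally show ?thesis .
qed

lemma src_vimage_borel: "A \<in> sets borel \<Longrightarrow> src G -` A \<in> sets borel"
  and rng_vimage_borel: "A \<in> sets borel \<Longrightarrow> rng G -` A \<in> sets borel"
  using measurable_sets[OF borel_measurable_continuous_onI[OF continuous_src[of UNIV]], of A]
    measurable_sets[OF borel_measurable_continuous_onI[OF continuous_rng[of UNIV]], of A] by simp_all

text \<open>The arrows that start in \<open>A\<close> form a null set. Inversion turns them into the arrows that end in \<open>A\<close>, which are
  therefore null by quasi-invariance.\<close>

lemma AE_arrows_avoid_null_set: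
  assumes qi: "quasi_invariant G \<mu>" and A: "A \<in> null_sets \<mu>"
  shows "AE u in \<mu>. \<forall>g. src G g = u \<longrightarrow> rng G g \<notin> A"
proof -
  have [measurable]: "A \<in> sets borel" using A by (auto simp: null_sets_def sets_\<mu>_iff)
  have "AE u in \<mu>. src G -` A \<inter> src G -` {u} = {}"
    using AE_not_in[OF A] by eventually_elim auto
  then have src: "src G -` A \<in> null_sets (groupoid_measure G \<mu>)"
    by (simp add: null_sets_groupoid_measure_iff src_vimage_borel)
  have ginv: "ginv G \<in> measurable (groupoid_measure G \<mu>) borel"
    using borel_measurable_continuous_onI[OF continuous_ginv] by (simp cong: measurable_cong_sets)
  have "ginv G -` (rng G -` A) = src G -` A" by auto
  then have "rng G -` A \<in> null_sets (groupoid_measure_inv G \<mu>)"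
    using src ginv by (simp add: groupoid_measure_inv_def null_sets_distr_iff rng_vimage_borel)
  then have "rng G -` A \<in> null_sets (groupoid_measure G \<mu>)"
    using qi by (auto simp: quasi_invariant_def absolutely_continuous_def)
  then have "AE u in \<mu>. rng G -` A \<inter> src G -` {u} = {}"
    by (simp add: null_sets_groupoid_measure_iff rng_vimage_borel)
  then show ?thesis by eventually_elim auto
qed

text \<open>This form of the preimage gives both its measurability, as a source image, and its nullity for null
  \<open>A\<close>, as a set of sources of arrows that end in \<open>A\<close>.\<close>

lemma slice_action_swap_vimage:
  assumes T: "compact_open_slice G T" and disj: "src G ` T \<inter> rng G ` T = {}"
  shows "slice_action G (swap_slice T) -` A \<inter> unit_space G = src G ` (swap_slice T \<inter> rng G -` A)"
proof -
  have sT: "slice G T" using T by (simp add: compact_open_slice_def)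
  show ?thesis
  proof (intro equalityI subsetI)
    fix u assume u: "u \<in> slice_action G (swap_slice T) -` A \<inter> unit_space G"
    then obtain g where "g \<in> swap_slice T" "u = src G g" using src_swap[OF sT disj] by blast
    then show "u \<in> src G ` (swap_slice T \<inter> rng G -` A)"
      using u slice_action_swap[OF sT disj] by auto
  qed (use slice_action_swap[OF sT disj] in auto)
qed

lemma nonsingular_involution_swap:
  assumes qi: "quasi_invariant G \<mu>"
    and T: "compact_open_slice G T" and disj: "src G ` T \<inter> rng G ` T = {}"
  shows "nonsingular_involution \<mu> (slice_action G (swap_slice T))"
  unfolding nonsingular_involution_def space_\<mu>
proof (intro conjI ballI)
  have sT: "slice G T" using T by (simp add: compact_open_slice_def)
  have "open (swap_slice T)"
    using swap_in_full_group[OF T disj] by (simp add: topological_full_group_def compact_open_slice_def)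
  then have meas: "slice_action G (swap_slice T) -` A \<inter> unit_space G \<in> sets \<mu>" if "A \<in> sets borel" for A
    unfolding slice_action_swap_vimage[OF T disj] using that
    by (intro src_image_measurable sets.Int rng_vimage_borel) auto
  show "slice_action G (swap_slice T) \<in> measurable \<mu> \<mu>"
    using meas slice_action_swap_units[OF sT disj]
    by (intro measurableI) (auto simp: space_\<mu> sets_\<mu>_iff)
  show "slice_action G (swap_slice T) (slice_action G (swap_slice T) u) = u" if "u \<in> unit_space G" for u
    by (rule slice_action_swap_involution[OF sT disj that])
  fix A assume A: "A \<in> null_sets \<mu>"
  show "slice_action G (swap_slice T) -` A \<inter> unit_space G \<in> null_sets \<mu>"
  proof (rule AE_iff_null_sets[THEN iffD2])
    show "slice_action G (swap_slice T) -` A \<inter> unit_space G \<in> sets \<mu>"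
      using A by (intro meas) (auto simp: null_sets_def sets_\<mu>_iff)
    show "AE u in \<mu>. u \<notin> slice_action G (swap_slice T) -` A \<inter> unit_space G"
      using AE_arrows_avoid_null_set[OF qi A]
      unfolding slice_action_swap_vimage[OF T disj] by eventually_elim auto
  qed
qed

text \<open>Almost every unit \<open>u\<close> satisfies \<open>u \<in> Y \<longleftrightarrow> \<alpha> u \<in> Y\<close> for countably many involutions \<open>\<alpha>\<close> whose
  slices cover the arrows with distinct source and range. An arrow that starts at such a unit has both ends in
  \<open>Y\<close> or both outside.\<close>

lemma ergodic_swaps:
  assumes qi: "quasi_invariant G \<mu>" and erg: "ergodic G \<mu>" and Y: "Y \<in> sets \<mu>"
    and inv: "\<And>T. compact_open_slice G T \<Longrightarrow> src G ` T \<inter> rng G ` T = {} \<Longrightarrow>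
      slice_action G (swap_slice T) -` Y \<inter> unit_space G - Y \<in> null_sets \<mu>"
  shows "Y \<in> null_sets \<mu> \<or> space \<mu> - Y \<in> null_sets \<mu>"
proof -
  define \<F> where "\<F> = {T. compact_open_slice G T \<and> src G ` T \<inter> rng G ` T = {}}"
  have "\<And>T. T \<in> \<F> \<Longrightarrow> open T" by (simp add: \<F>_def compact_open_slice_def)
  then obtain \<F>' where F: "\<F>' \<subseteq> \<F>" "countable \<F>'" "\<Union>\<F>' = \<Union>\<F>"
    by (rule Lindelof)
  have AE_T: "AE u in \<mu>. u \<in> Y \<longleftrightarrow> slice_action G (swap_slice T) u \<in> Y" if "T \<in> \<F>" for T
  proof -
    let ?\<alpha> = "slice_action G (swap_slice T)"
    have T: "compact_open_slice G T" "src G ` T \<inter> rng G ` T = {}" using that by (auto simp: \<F>_def)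
    note \<alpha> = nonsingular_involutionD[OF nonsingular_involution_swap[OF qi T]]
    have "?\<alpha> -` (?\<alpha> -` Y \<inter> unit_space G - Y) \<inter> space \<mu> \<in> null_sets \<mu>"
      by (rule \<alpha>(3)[OF inv[OF T]])
    \<comment> \<open>One inclusion up to null sets is given; its preimage under the involution is the other one.\<close>
    from AE_not_in[OF this] AE_not_in[OF inv[OF T]] AE_space show ?thesis
    proof eventually_elim
      fix u assume "u \<notin> ?\<alpha> -` (?\<alpha> -` Y \<inter> unit_space G - Y) \<inter> space \<mu>"
        "u \<notin> ?\<alpha> -` Y \<inter> unit_space G - Y" "u \<in> space \<mu>"
      then show "u \<in> Y \<longleftrightarrow> ?\<alpha> u \<in> Y"
        using \<alpha>(2)[of u] measurable_space[OF \<alpha>(1), of u] by (auto simp: space_\<mu>)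
    qed
  qed
  have AE_all: "AE u in \<mu>. \<forall>T\<in>\<F>'. u \<in> Y \<longleftrightarrow> slice_action G (swap_slice T) u \<in> Y"
    using AE_T F by (intro AE_ball_countable') auto
  define D where "D = {g. \<not> (src G g \<in> Y \<longleftrightarrow> rng G g \<in> Y)}"
  have Yb: "Y \<in> sets borel" using Y by (simp add: sets_\<mu>_iff)
  have "D = (src G -` Y - rng G -` Y) \<union> (rng G -` Y - src G -` Y)" by (auto simp: D_def)
  then have Db: "D \<in> sets borel" using Yb by (auto intro!: sets.Un sets.Diff src_vimage_borel rng_vimage_borel)
  have "AE u in \<mu>. D \<inter> src G -` {u} = {}"
    using AE_all
  proof eventually_elim
    fix u assume u: "\<forall>T\<in>\<F>'. u \<in> Y \<longleftrightarrow> slice_action G (swap_slice T) u \<in> Y"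
    have "g \<notin> D" if g: "src G g = u" for g
    proof (cases "src G g = rng G g")
      case False
      obtain S where "compact_open_slice G S" "src G ` S \<inter> rng G ` S = {}" "g \<in> S"
        using compact_open_slice_basis[OF False] by metis
      then have "g \<in> \<Union>\<F>'" unfolding F(3) by (auto simp: \<F>_def)
      then obtain T where T: "T \<in> \<F>'" "g \<in> T" by auto
      then have *: "slice G T" "src G ` T \<inter> rng G ` T = {}" using F(1) by (auto simp: \<F>_def compact_open_slice_def)
      have "slice_action G (swap_slice T) u = rng G g"
        using slice_action_swap_src[OF * T(2)] g by simp
      then show ?thesis using u T(1) g by (auto simp: D_def)
    qed (simp add: D_def)
    then show "D \<inter> src G -` {u} = {}" by auto
  qed
  then have "D \<in> null_sets (groupoid_measure G \<mu>)"
    by (simp add: null_sets_groupoid_measure_iff[OF Db])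
  then have "almost_invariant G \<mu> Y"
    unfolding almost_invariant_def by (rule AE_I') (auto simp: D_def)
  then show ?thesis using erg Y by (auto simp: ergodic_def null_sets_def)
qed

end

section \<open>Irreducibility\<close>

context measured_etale_cantor_groupoid begin

context
  fixes H
  assumes qi: "quasi_invariant G \<mu>" and H: "closed_L2_subspace \<mu> H"
    and stable: "\<And>T f. compact_open_slice G T \<Longrightarrow> src G ` T \<inter> rng G ` T = {} \<Longrightarrow> f \<in> H \<Longrightarrow>
      weighted_composition \<mu> (slice_action G (swap_slice T)) f \<in> H"
begin

interpretation H: closed_L2_subspace \<mu> H by (rule H)

text \<open>The involutions along disjoint copies of \<open>W\<close> show that \<open>H\<close> contains, with \<open>f\<close>, its restriction
  to the complement of \<open>W\<close>, and so also the difference of the two.\<close>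

lemma reducing_off_range:
  assumes R: "compact_open_slice G R1" "src G ` R1 = unit_space G"
      "compact_open_slice G R2" "src G ` R2 = unit_space G" "rng G ` R1 \<inter> rng G ` R2 = {}"
    and W: "clopen W" "W \<inter> rng G ` R1 = {}"
  shows "H.reducing W"
proof (rule H.reducingI)
  show Wm: "W \<in> sets \<mu>" by (rule clopen_sets[OF W(1)])
  obtain T :: "nat \<Rightarrow> 'g set" where T: "\<And>n. compact_open_slice G (T n)" "\<And>n. src G ` T n = W"
    "\<And>n. W \<inter> rng G ` T n = {}" "disjoint_family (\<lambda>n. rng G ` T n)"
    using wandering_copies[OF R W] by metis
  have disj: "src G ` T n \<inter> rng G ` T n = {}" for n using T by simp
  have sT: "slice G (T n)" for n using T(1)[of n] by (simp add: compact_open_slice_def)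
  note act_src = slice_action_swap_src[OF sT disj] and act_rng = slice_action_swap_rng[OF sT disj]
    and act_fixed = slice_action_swap_fixed[OF sT disj]
  fix f assume f: "f \<in> H"
  have "(\<lambda>x. indicator (- W) x * f x) \<in> H"
  proof (rule H.restrict_away_from_wandering_set[OF f Wm _ T(4,3)])
    show "rng G ` T n \<in> sets \<mu>" for n by (rule clopen_sets[OF clopen_rng_image[OF T(1)]])
    show "nonsingular_involution \<mu> (slice_action G (swap_slice (T n)))" for n
      by (rule nonsingular_involution_swap[OF qi T(1) disj])
    show "weighted_composition \<mu> (slice_action G (swap_slice (T n))) f \<in> H" for n
      by (rule stable[OF T(1) disj f])
    show "slice_action G (swap_slice (T n)) u = u" if "u \<in> space \<mu> - (W \<union> rng G ` T n)" for n u
      using that T(2) by (intro act_fixed) (auto simp: space_\<mu>)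
    show "slice_action G (swap_slice (T n)) u \<in> W \<longleftrightarrow> u \<in> rng G ` T n" if u: "u \<in> space \<mu>" for n u
    proof -
      consider "u \<in> rng G ` T n" | "u \<in> W" | "u \<notin> W" "u \<notin> rng G ` T n" by blast
      then show ?thesis
      proof cases
        case 1
        then obtain g where "g \<in> T n" "u = rng G g" by auto
        then show ?thesis using act_rng[of g n] T(2)[of n] by auto
      next
        case 2
        then obtain g where g: "g \<in> T n" "u = src G g" using T(2)[of n] by auto
        then have "slice_action G (swap_slice (T n)) u \<in> rng G ` T n" using act_src[of g n] by simp
        then show ?thesis using T(3)[of n] 2 by blast
      next
        case 3
        then show ?thesis using act_fixed[of u n] T(2) u by (simp add: space_\<mu>)
      qed
    qed
  qed
  from H.diff[OF f this] have "(\<lambda>x. f x - indicator (- W) x * f x) \<in> H" .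
  also have "(\<lambda>x. f x - indicator (- W) x * f x) = (\<lambda>x. indicator W x * f x)"
    by (auto simp: indicator_def)
  finally show "(\<lambda>x. indicator W x * f x) \<in> H" .
qed

text \<open>The part of \<open>W\<close> outside the range of \<open>S1\<close> misses the range of \<open>S1\<close>, the part inside misses the range
  of \<open>S2\<close>.\<close>

lemma reducing_clopen:
  assumes S: "compact_open_slice G S1" "src G ` S1 = unit_space G"
      "compact_open_slice G S2" "src G ` S2 = unit_space G" "rng G ` S1 \<inter> rng G ` S2 = {}"
    and W: "clopen W"
  shows "H.reducing W"
proof -
  have "H.reducing (W - rng G ` S1)"
    by (rule reducing_off_range[OF S]) (use S W in \<open>auto intro: clopen_Diff clopen_rng_image\<close>)
  moreover have "H.reducing (W \<inter> rng G ` S1)"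
    by (rule reducing_off_range[OF S(3,4,1,2)]) (use S W in \<open>auto intro: clopen_Int clopen_rng_image\<close>)
  ultimately have "H.reducing ((W - rng G ` S1) \<union> (W \<inter> rng G ` S1))" by (rule H.reducing_Un)
  also have "(W - rng G ` S1) \<union> (W \<inter> rng G ` S1) = W" by blast
  finally show ?thesis .
qed

end

end

theorem corollary3p6p10:
  fixes G :: "'g::second_countable_topology groupoid" and \<mu> :: "'g measure"
  assumes "etale_groupoid G"
    and "cantor_groupoid G"
    and "purely_infinite G"
    and "minimal_groupoid G"
    and "prob_space \<mu>"
    and "sets \<mu> = sets (restrict_space borel (unit_space G))"
    and "quasi_invariant G \<mu>"
    and "ergodic G \<mu>"
  shows "irreducible_on_L2 (topological_full_group G) \<mu>
           (koopman (topological_full_group G) (slice_action G) \<mu>)"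
proof -
  interpret etale_groupoid G by fact
  interpret prob_space \<mu> by fact
  interpret measured_etale_cantor_groupoid G \<mu>
    using assms(2,6) by unfold_locales
  note qi = assms(7)
  have "properly_infinite G (unit_space G)"
    using assms(3) clopen_units by (simp add: purely_infinite_def clopen_alt)
  then obtain S1 S2 where S: "compact_open_slice G S1" "src G ` S1 = unit_space G"
    "compact_open_slice G S2" "src G ` S2 = unit_space G" "rng G ` S1 \<inter> rng G ` S2 = {}"
    unfolding properly_infinite_def by metis
  show ?thesis
    unfolding irreducible_on_L2_def
  proof (intro allI impI)
    fix V assume V: "closed_subspace_L2 \<mu> V \<and>
      (\<forall>\<gamma>\<in>carrier (topological_full_group G). \<forall>F\<in>V. koopman (topological_full_group G) (slice_action G) \<mu> \<gamma> F \<in> V)"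
    define H where "H = {f \<in> square_integrable \<mu>. L2_class \<mu> f \<in> V}"
    interpret H: closed_L2_subspace \<mu> H
      unfolding H_def by (rule closed_L2_subspace_of_classes) (use V in blast)
    have stable: "weighted_composition \<mu> (slice_action G (swap_slice T)) f \<in> H"
      if T: "compact_open_slice G T" "src G ` T \<inter> rng G ` T = {}" and f: "f \<in> H" for T f
    proof -
      have sT: "slice G T" using T by (simp add: compact_open_slice_def)
      note \<gamma> = swap_in_full_group[OF T]
      note \<alpha> = nonsingular_involution_swap[OF qi T]
      have f': "f \<in> square_integrable \<mu>" "L2_class \<mu> f \<in> V" using f by (auto simp: H_def)
      have "koopman (topological_full_group G) (slice_action G) \<mu> (swap_slice T) (L2_class \<mu> f) \<in> V"
        using V \<gamma> f'(2) by blast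
      then have "L2_class \<mu> (weighted_composition \<mu> (slice_action G (swap_slice T)) f) \<in> V"
        unfolding koopman_involution[where \<alpha> = "slice_action G", OF \<alpha> inv_swap[OF sT T(2) \<gamma>] f'(1)] .
      then show ?thesis using weighted_composition_L2(1)[OF \<alpha> f'(1)] by (simp add: H_def)
    qed
    have reducing: "H.reducing E" if "E \<in> sets \<mu>" for E
    proof (rule H.reducing_all[OF sets_\<mu>_generated_by_clopen _ that])
      fix W assume "W \<in> Collect clopen"
      then show "H.reducing W"
        by (intro reducing_clopen[OF qi H.closed_L2_subspace_axioms stable S]) simp_all
    qed
    have "H = square_integrable \<mu> \<or> (\<forall>f\<in>H. AE x in \<mu>. f x = 0)"
    proof (rule H.trivial_if_ergodic[where I = "{slice_action G (swap_slice T) | T.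
        compact_open_slice G T \<and> src G ` T \<inter> rng G ` T = {}}"])
      show "E \<in> sets \<mu> \<Longrightarrow> H.reducing E" for E by (rule reducing)
    next
      fix Y assume Y: "Y \<in> sets \<mu>" and null: "\<And>\<alpha>. \<alpha> \<in> {slice_action G (swap_slice T) | T.
        compact_open_slice G T \<and> src G ` T \<inter> rng G ` T = {}} \<Longrightarrow> \<alpha> -` Y \<inter> space \<mu> - Y \<in> null_sets \<mu>"
      show "Y \<in> null_sets \<mu> \<or> space \<mu> - Y \<in> null_sets \<mu>"
        by (rule ergodic_swaps[OF qi assms(8) Y]) (use null in \<open>auto simp: space_\<mu>\<close>)
    next
      fix \<alpha> assume "\<alpha> \<in> {slice_action G (swap_slice T) | T.
        compact_open_slice G T \<and> src G ` T \<inter> rng G ` T = {}}"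
      then obtain T where T: "compact_open_slice G T" "src G ` T \<inter> rng G ` T = {}"
        "\<alpha> = slice_action G (swap_slice T)" by blast
      show "nonsingular_involution \<mu> \<alpha>" unfolding T(3) by (rule nonsingular_involution_swap[OF qi T(1,2)])
      show "weighted_composition \<mu> \<alpha> f \<in> H" if "f \<in> H" for f
        unfolding T(3) by (rule stable[OF T(1,2) that])
    qed
    moreover have V_sub: "V \<subseteq> L2 \<mu>" and V0: "L2_class \<mu> (\<lambda>_. 0) \<in> V"
      using V by (auto simp: closed_subspace_L2_def)
    ultimately consider "H = square_integrable \<mu>" | "\<forall>f\<in>H. AE x in \<mu>. f x = 0" by blast
    then show "V = {L2_class \<mu> (\<lambda>_. 0)} \<or> V = L2 \<mu>"
    proof cases
      case 1
      have "L2 \<mu> \<subseteq> V"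
      proof
        fix F assume "F \<in> L2 \<mu>"
        then obtain f where "f \<in> square_integrable \<mu>" "F = L2_class \<mu> f" by (rule L2_cases)
        then show "F \<in> V" using 1 by (auto simp: H_def)
      qed
      then show ?thesis using V_sub by blast
    next
      case 2
      have "F = L2_class \<mu> (\<lambda>_. 0)" if F: "F \<in> V" for F
      proof -
        obtain f where f: "f \<in> square_integrable \<mu>" "F = L2_class \<mu> f" using F V_sub by (blast elim: L2_cases)
        then have "f \<in> H" using F by (simp add: H_def)
        then show ?thesis
          unfolding f(2) using 2 by (intro L2_class_eqI f(1) H.mem_square_integrable[OF H.zero]) simp
      qed
      then show ?thesis using V0 by blast
    qed
  qed
qed

end
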